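(* Fix $\gamma>0$ and $\beta\neq 0$. Let $k>0$ be arbitrary if $\beta<0$, and let $k>0$ satisfy $k\neq\left(\frac{\gamma}{\beta n^2}\right)^{1/4}$ for every integer $n\ge 2$ if $\beta>0$. Set $c_0=\frac{\gamma}{k^2}+\beta k^2$. Then there is a one-parameter family of solutions $(w(a;k),c(a;k))$, $a\in\mathbb{R}$ with $|a|$ sufficiently small, of $$ck^2 w''+\beta k^4 w''''-k^2(w^2)''+\gamma w=0,$$ so that $u(x,t)=w(a;k)\big(k(x-c(a;k)t)\big)$ is a traveling-wave solution of the Ostrovsky equation $(u_t-\beta u_{xxx}+(u^2)_x)_x=\gamma u$. Here $w(a;k)(\cdot)$ is $2\pi$-periodic, even and smooth in its argument, $c(a;k)$ is even in $a$, and $w(a;k)$, $c(a;k)$ depend analytically on $a$ and $k$. Moreover, as $a\to 0$, $$w(a;k)(z)=a\cos z+a^2A_2\cos 2z+a^3A_3\cos 3z+a^4(A_{42}\cos 2z+A_{44}\cos 4z)+O(a^5),$$ $$c(a;k)=c_0+a^2c_2+a^4c_4+O(a^6),$$ where $$A_2=\frac{2k^2}{3\gamma-12\beta k^4},\quad A_3=\frac{9k^2A_2}{8\gamma-72\beta k^4},\quad A_{42}=2A_2A_3-2A_2^3,\quad A_{44}=\frac{8k^2(A_2^2+2A_3)}{15\gamma-240\beta k^4},$$ $$c_2=A_2,\qquad c_4=3A_2A_3-2A_2^3.$$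
   Context: $\gamma>0$ and $\beta\neq0$ are fixed real parameters of the Ostrovsky equation $(u_t-\beta u_{xxx}+(u^2)_x)_x=\gamma u$, $x\in\mathbb{R}$. Primes denote derivatives with respect to $z$. The solution $w$ is sought in $H^4(\mathbb{T})$, the Sobolev space of $2\pi$-periodic functions. *)

theory Defs
  imports "HOL-Analysis.Analysis"
begin

definition admissible_k :: "real \<Rightarrow> real \<Rightarrow> real \<Rightarrow> bool" where
  "admissible_k \<gamma> \<beta> k \<longleftrightarrow> k > 0 \<and>
     (\<beta> > 0 \<longrightarrow> (\<forall>n::nat. n \<ge> 2 \<longrightarrow> k \<noteq> (\<gamma> / (\<beta> * (real n)^2)) powr (1/4)))"

definition dz :: "nat \<Rightarrow> (real \<Rightarrow> real) \<Rightarrow> real \<Rightarrow> real" where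
  "dz j f = (deriv ^^ j) f"

definition smooth_fun :: "(real \<Rightarrow> real) \<Rightarrow> bool" where
  "smooth_fun f \<longleftrightarrow> (\<forall>j z. dz j f differentiable (at z))"

text \<open>Real-analytic dependence on (a,k) in U of a family of functions of z, with values in the
  Banach space of bounded functions (sup norm): locally a double power series in (a-a0, k-k0)
  whose coefficient functions are bounded by M i j with absolutely convergent majorant series.\<close>
definition fam_analytic_on :: "(real \<Rightarrow> real \<Rightarrow> real \<Rightarrow> real) \<Rightarrow> (real \<times> real) set \<Rightarrow> bool" where
  "fam_analytic_on F U \<longleftrightarrow>
    (\<forall>(a0, k0) \<in> U. \<exists>r > 0. \<exists>C :: nat \<Rightarrow> nat \<Rightarrow> real \<Rightarrow> real. \<exists>M :: nat \<Rightarrow> nat \<Rightarrow> real.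
       (\<forall>i j z. \<bar>C i j z\<bar> \<le> M i j) \<and>
       (\<forall>a k. (a - a0)^2 + (k - k0)^2 < r^2 \<longrightarrow>
          (\<lambda>(i, j). M i j * \<bar>a - a0\<bar>^i * \<bar>k - k0\<bar>^j) summable_on UNIV \<and>
          (\<forall>z. ((\<lambda>(i, j). C i j z * (a - a0)^i * (k - k0)^j) has_sum F a k z) UNIV)))"

definition c0_coef :: "real \<Rightarrow> real \<Rightarrow> real \<Rightarrow> real" where
  "c0_coef \<gamma> \<beta> k = \<gamma> / k^2 + \<beta> * k^2"
definition A2_coef :: "real \<Rightarrow> real \<Rightarrow> real \<Rightarrow> real" where
  "A2_coef \<gamma> \<beta> k = 2 * k^2 / (3 * \<gamma> - 12 * \<beta> * k^4)"
definition A3_coef :: "real \<Rightarrow> real \<Rightarrow> real \<Rightarrow> real" where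
  "A3_coef \<gamma> \<beta> k = 9 * k^2 * A2_coef \<gamma> \<beta> k / (8 * \<gamma> - 72 * \<beta> * k^4)"
definition A42_coef :: "real \<Rightarrow> real \<Rightarrow> real \<Rightarrow> real" where
  "A42_coef \<gamma> \<beta> k = 2 * A2_coef \<gamma> \<beta> k * A3_coef \<gamma> \<beta> k - 2 * (A2_coef \<gamma> \<beta> k)^3"
definition A44_coef :: "real \<Rightarrow> real \<Rightarrow> real \<Rightarrow> real" where
  "A44_coef \<gamma> \<beta> k = 8 * k^2 * ((A2_coef \<gamma> \<beta> k)^2 + 2 * A3_coef \<gamma> \<beta> k) / (15 * \<gamma> - 240 * \<beta> * k^4)"
definition c2_coef :: "real \<Rightarrow> real \<Rightarrow> real \<Rightarrow> real" where
  "c2_coef \<gamma> \<beta> k = A2_coef \<gamma> \<beta> k"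
definition c4_coef :: "real \<Rightarrow> real \<Rightarrow> real \<Rightarrow> real" where
  "c4_coef \<gamma> \<beta> k = 3 * A2_coef \<gamma> \<beta> k * A3_coef \<gamma> \<beta> k - 2 * (A2_coef \<gamma> \<beta> k)^3"

end

theory Submission
  imports Defs "HOL-Complex_Analysis.Complex_Analysis"
begin

text \<open>The wave is constructed as its Stokes expansion \<open>w = \<Sum>\<^sub>n a\<^sup>n w\<^sub>n\<close>, \<open>c = c\<^sub>0 + \<Sum>\<^sub>n a\<^sup>n d\<^sub>n\<close>,
  normalised so that the first Fourier mode of \<open>w\<close> is exactly \<open>a cos z\<close>.  At order \<open>a\<^sup>n\<close> the
  equation determines every mode of \<open>w\<^sub>n\<close> with frequency \<open>m \<ge> 2\<close>, because the linear symbol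
  \<open>(m\<^sup>2 - 1)(\<gamma> - \<beta> k\<^sup>4 m\<^sup>2)\<close> does not vanish there, while the solvability condition at frequency
  \<open>1\<close> determines \<open>d\<^sub>n\<close>.  Near an admissible \<open>k\<close>, complex values included, the inverse symbol times
  \<open>k\<^sup>2 m\<^sup>2\<close> is bounded uniformly in \<open>m\<close>, so a majorant argument in the \<open>\<ell>\<^sup>1\<close> norm of the Fourier
  coefficients gives a geometric bound for \<open>w\<^sub>n\<close>.  Since \<open>w\<^sub>n\<close> has no frequency above \<open>n\<close>, the same bound
  controls all derivatives in \<open>z\<close>, and since the coefficients are holomorphic in \<open>k\<close>, Cauchy's
  inequality gives joint analyticity in \<open>(a, k)\<close>.\<close>

section \<open>Trigonometric polynomials\<close>

text \<open>The linear part with speed c_0 acts on frequency m by (m^2 - 1)(\<beta> k^4 m^2 -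
  \<gamma>); the value of c_0 is exactly the one that puts cos z into its kernel. The quadratic term
  carries two derivatives against four in the linear part, so away from resonant \<open>k\<close>
  the recursion meets neither small divisors nor a loss of derivatives.

  The obstacle is the unknown speed. Order n of (c - c_0) w'' involves all earlier speed
  coefficients, and each of these is itself quadratic in the entries, so the recursion is
  effectively cubic. It is still triangular: a speed coefficient of order i is read off the square
  at order i + 1, which contains only entries of order at most i.

  Differentiating j times in z multiplies order n by at most n^j. This is absorbed by a factor 3^n,
  at the price of a constant depending on j only, so one radius in \<open>a\<close> serves every
  derivative. Finally, wave and speed are explicit formulas in \<open>a\<close> and
  \<open>k\<close>; the constructions near different \<open>k\<close> therefore agree by definition
  and need no gluing.\<close>

definition l1_norm :: "complex poly \<Rightarrow> real" where
  "l1_norm p = (\<Sum>i\<le>degree p. norm (coeff p i))"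

lemma l1_norm_eq:
  assumes "degree p \<le> n"
  shows "l1_norm p = (\<Sum>i\<le>n. norm (coeff p i))"
  unfolding l1_norm_def using assms by (intro sum.mono_neutral_left) (auto simp: coeff_eq_0)

lemma l1_norm_nonneg [simp]: "l1_norm p \<ge> 0"
  by (simp add: l1_norm_def sum_nonneg)

lemma l1_norm_0 [simp]: "l1_norm 0 = 0"
  by (simp add: l1_norm_def)

lemma coeff_le_l1_norm: "norm (coeff p i) \<le> l1_norm p"
proof (cases "i \<le> degree p")
  case True
  thus ?thesis unfolding l1_norm_def
    by (intro member_le_sum) auto
qed (auto simp: coeff_eq_0)

lemma l1_norm_pCons: "l1_norm (pCons a p) = norm a + l1_norm p"
proof -
  have "l1_norm (pCons a p) = (\<Sum>i\<le>Suc (degree p). norm (coeff (pCons a p) i))"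
    by (rule l1_norm_eq) (simp add: degree_pCons_le)
  thus ?thesis unfolding sum.atMost_Suc_shift by (simp add: l1_norm_def)
qed

lemma l1_norm_add: "l1_norm (p + q) \<le> l1_norm p + l1_norm q"
proof -
  define n where "n = max (degree p) (degree q)"
  have "l1_norm (p + q) = (\<Sum>i\<le>n. norm (coeff (p + q) i))"
    by (rule l1_norm_eq) (auto simp: n_def degree_add_le_max)
  also have "\<dots> \<le> (\<Sum>i\<le>n. norm (coeff p i)) + (\<Sum>i\<le>n. norm (coeff q i))"
    by (auto simp: sum.distrib[symmetric] intro!: sum_mono norm_triangle_ineq)
  finally show ?thesis
    by (simp add: l1_norm_eq[of p n] l1_norm_eq[of q n] n_def)
qed

lemma l1_norm_smult: "l1_norm (smult c p) = norm c * l1_norm p"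
  by (simp add: l1_norm_eq[of _ "degree p"] degree_smult_le norm_mult sum_distrib_left)

lemma l1_norm_diff: "l1_norm (p - q) \<le> l1_norm p + l1_norm q"
  using l1_norm_add[of p "smult (-1) q"] l1_norm_smult[of "-1" q] by simp

lemma l1_norm_sum: "l1_norm (\<Sum>i\<in>A. f i) \<le> (\<Sum>i\<in>A. l1_norm (f i))"
  by (induction A rule: infinite_finite_induct) (auto intro: order.trans[OF l1_norm_add])

lemma l1_norm_mult: "l1_norm (p * q) \<le> l1_norm p * l1_norm q"
proof (induction p)
  case (pCons a p)
  have "l1_norm (pCons a p * q) \<le> l1_norm (smult a q) + l1_norm (pCons 0 (p * q))"
    by (simp only: mult_pCons_left l1_norm_add)
  also have "\<dots> \<le> norm a * l1_norm q + l1_norm p * l1_norm q"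
    using pCons.IH by (simp add: l1_norm_smult l1_norm_pCons)
  finally show ?case by (simp add: l1_norm_pCons ring_distribs)
qed auto

text \<open>A factor \<open>monom 1 t\<close> only re-encodes the same trigonometric polynomial at
  an order higher by \<open>2 * t\<close>. Drift terms therefore cost no more than their speed
  coefficient.\<close>

lemma l1_norm_monom_mult: "l1_norm (monom 1 t * p) = l1_norm p"
  by (induction t) (simp_all add: monom_0 monom_Suc l1_norm_pCons one_pCons)

text \<open>The \<open>n\<close>-th entry of an expansion is a trigonometric polynomial whose frequencies have the
  parity of \<open>n\<close> and are at most \<open>n\<close>; it is stored as the ordinary polynomial of degree at most
  \<open>n\<close> whose coefficient \<open>l\<close> belongs to the frequency \<open>2 l - n\<close>.  With this encoding products of
  expansions are products of polynomials.\<close>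

definition freq :: "nat \<Rightarrow> nat \<Rightarrow> int" where
  "freq n l = 2 * int l - int n"

text \<open>\<open>j\<close> counts derivatives in \<open>z\<close>: each one multiplies a mode by i
  times its frequency.\<close>

definition trig :: "nat \<Rightarrow> complex poly \<Rightarrow> nat \<Rightarrow> real \<Rightarrow> complex" where
  "trig j p n z = (\<Sum>l\<le>n. coeff p l * (\<i> * of_int (freq n l)) ^ j * cis (of_int (freq n l) * z))"

text \<open>Indices \<open>l\<close> and \<open>n - l\<close> carry opposite frequencies, so this is
  evenness in \<open>z\<close>; the degree bound confines the frequencies to [-n, n].\<close>

definition palindromic :: "nat \<Rightarrow> complex poly \<Rightarrow> bool" where
  "palindromic n p \<longleftrightarrow> degree p \<le> n \<and> (\<forall>l\<le>n. coeff p (n - l) = coeff p l)"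

lemma palindromicD: "palindromic n p \<Longrightarrow> l \<le> n \<Longrightarrow> coeff p (n - l) = coeff p l"
  unfolding palindromic_def by blast

lemma palindromic_0 [simp]: "palindromic n 0"
  by (simp add: palindromic_def)

lemma palindromic_add: "palindromic n p \<Longrightarrow> palindromic n q \<Longrightarrow> palindromic n (p + q)"
  by (auto simp: palindromic_def degree_add_le)

lemma palindromic_diff: "palindromic n p \<Longrightarrow> palindromic n q \<Longrightarrow> palindromic n (p - q)"
  by (auto simp: palindromic_def degree_diff_le)

lemma palindromic_smult: "palindromic n p \<Longrightarrow> palindromic n (smult c p)"
  by (auto simp: palindromic_def intro: order.trans[OF degree_smult_le])

lemma palindromic_sum: "(\<And>i. i \<in> A \<Longrightarrow> palindromic n (f i)) \<Longrightarrow> palindromic n (\<Sum>i\<in>A. f i)"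
  by (induction A rule: infinite_finite_induct) (auto intro: palindromic_add)

text \<open>The convolution is cut down to the rectangle of possible indices, because the rectangle,
  unlike the triangle of the usual formula, is invariant under the reflection (x, y) -> (i - x, j -
  y).\<close>

lemma coeff_mult_bounded:
  fixes p q :: "'a::comm_semiring_0 poly"
  assumes "degree p \<le> i" "degree q \<le> j"
  shows "coeff (p * q) l = (\<Sum>(x, y)\<in>{(x, y). x \<le> i \<and> y \<le> j \<and> x + y = l}. coeff p x * coeff q y)"
proof -
  have "coeff (p * q) l = (\<Sum>(x, y)\<in>{(x, y). x + y = l}. coeff p x * coeff q y)"
    unfolding coeff_mult
    by (rule sum.reindex_bij_witness[of _ fst "\<lambda>x. (x, l - x)"]) auto
  also have "\<dots> = (\<Sum>(x, y)\<in>{(x, y). x \<le> i \<and> y \<le> j \<and> x + y = l}. coeff p x * coeff q y)"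
  proof (rule sum.mono_neutral_right)
    have "{(x, y). x + y = l} \<subseteq> {..l} \<times> {..l}" by auto
    thus "finite {(x, y). x + y = l}" by (rule finite_subset) auto
    show "\<forall>i\<in>{(x, y). x + y = l} - {(x, y). x \<le> i \<and> y \<le> j \<and> x + y = l}.
       (case i of (x, y) \<Rightarrow> coeff p x * coeff q y) = 0"
      using assms by (auto dest!: mult_not_zero le_degree intro: order.trans)
  qed auto
  finally show ?thesis .
qed

lemma palindromic_mult:
  assumes "palindromic i p" "palindromic j q"
  shows "palindromic (i + j) (p * q)"
proof -
  have deg: "degree p \<le> i" "degree q \<le> j" using assms by (auto simp: palindromic_def)
  have "coeff (p * q) (i + j - l) = coeff (p * q) l" if "l \<le> i + j" for l
    unfolding coeff_mult_bounded[OF deg]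
    by (rule sum.reindex_bij_witness[of _ "\<lambda>(x, y). (i - x, j - y)" "\<lambda>(x, y). (i - x, j - y)"])
       (use that assms in \<open>auto simp: palindromic_def\<close>)
  moreover have "degree (p * q) \<le> i + j"
    using deg degree_mult_le[of p q] by linarith
  ultimately show ?thesis by (simp add: palindromic_def)
qed

text \<open>At order \<open>2 * t\<close> the polynomial \<open>monom 1 t\<close> has its only
  coefficient in the centre, at frequency 0: it encodes the constant 1.\<close>

lemma palindromic_monom_mult:
  assumes "palindromic (n - 2 * t) p" "2 * t \<le> n"
  shows "palindromic n (monom 1 t * p)"
proof -
  have "palindromic (2 * t) (monom (1::complex) t)"
    by (auto simp: palindromic_def degree_monom_eq)
  from palindromic_mult[OF this assms(1)] assms(2) show ?thesis by simp
qed

lemma norm_freq_le: "l \<le> n \<Longrightarrow> \<bar>real_of_int (freq n l)\<bar> \<le> real n"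
  by (auto simp: freq_def)

lemma norm_trig_le:
  assumes "degree p \<le> n"
  shows "norm (trig j p n z) \<le> real n ^ j * l1_norm p"
proof -
  have "norm (trig j p n z) \<le> (\<Sum>l\<le>n. norm (coeff p l) * real n ^ j)"
    unfolding trig_def
  proof (rule sum_norm_le)
    fix l assume "l \<in> {..n}"
    hence "\<bar>real_of_int (freq n l)\<bar> ^ j \<le> real n ^ j"
      by (intro power_mono norm_freq_le) auto
    thus "norm (coeff p l * (\<i> * of_int (freq n l)) ^ j * cis (of_int (freq n l) * z)) \<le> norm (coeff p l) * real n ^ j"
      by (simp add: norm_mult norm_power mult_left_mono)
  qed
  thus ?thesis using assms by (simp add: l1_norm_eq sum_distrib_left mult.commute)
qed

text \<open>Factoring out the lowest frequency leaves an ordinary polynomial in exp(2 i z), so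
  multiplicativity of \<open>trig 0\<close> becomes multiplicativity of \<open>poly\<close>.\<close>

lemma trig_eq_poly:
  assumes "degree p \<le> n"
  shows "trig 0 p n z = cis (- real n * z) * poly p (cis (2 * z))"
proof -
  have "poly p (cis (2 * z)) = (\<Sum>l\<le>n. coeff p l * cis (2 * z) ^ l)"
    unfolding poly_altdef using assms by (intro sum.mono_neutral_left) (auto simp: coeff_eq_0)
  thus ?thesis
    by (simp add: trig_def sum_distrib_left freq_def Complex.DeMoivre cis_mult algebra_simps)
qed

lemma trig_mult:
  assumes "degree p \<le> i" "degree q \<le> j"
  shows "trig 0 (p * q) (i + j) z = trig 0 p i z * trig 0 q j z"
  using assms degree_mult_le[of p q]
  by (simp add: trig_eq_poly cis_mult algebra_simps flip: cis_mult[of "- (real i * z)"])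

lemma trig_sum: "trig j (\<Sum>i\<in>A. f i) n z = (\<Sum>i\<in>A. trig j (f i) n z)"
  unfolding trig_def coeff_sum sum_distrib_right by (rule sum.swap)

lemma trig_smult: "trig j (smult c p) n z = c * trig j p n z"
  by (simp add: trig_def sum_distrib_left mult_ac)

text \<open>The shift moves coefficient \<open>l\<close> to \<open>l + t\<close>, and 2 (l + t) - n
  = 2 l - (n - 2 t): the frequency is unchanged.\<close>

lemma trig_monom_mult:
  assumes "degree p \<le> n - 2 * t" "2 * t \<le> n"
  shows "trig j (monom 1 t * p) n z = trig j p (n - 2 * t) z"
proof -
  have freq: "freq (n - 2 * t) l = freq n (l + t)" for l
    using assms(2) by (simp add: freq_def of_nat_diff)
  have "trig j p (n - 2 * t) z = (\<Sum>l\<in>{t..n - t}. coeff (monom 1 t * p) l * (\<i> * of_int (freq n l)) ^ j * cis (of_int (freq n l) * z))"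
    unfolding trig_def
    by (rule sum.reindex_bij_witness[of _ "\<lambda>l. l - t" "\<lambda>l. l + t"])
       (use assms in \<open>auto simp: freq coeff_monom_mult\<close>)
  also have "\<dots> = trig j (monom 1 t * p) n z"
    unfolding trig_def
  proof (rule sum.mono_neutral_left)
    show "\<forall>l\<in>{..n} - {t..n - t}. coeff (monom 1 t * p) l * (\<i> * of_int (freq n l)) ^ j * cis (of_int (freq n l) * z) = 0"
    proof
      fix l assume l: "l \<in> {..n} - {t..n - t}"
      hence "coeff (monom 1 t * p) l = 0"
        using assms by (auto simp: coeff_monom_mult intro!: coeff_eq_0)
      thus "coeff (monom 1 t * p) l * (\<i> * of_int (freq n l)) ^ j * cis (of_int (freq n l) * z) = 0" by simp
    qed
  qed auto
  finally show ?thesis ..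
qed

section \<open>Symmetry, periodicity and derivatives of trigonometric polynomials\<close>

definition real_coeffs :: "complex poly \<Rightarrow> bool" where
  "real_coeffs p \<longleftrightarrow> (\<forall>l. coeff p l \<in> \<real>)"

lemma trig_even:
  assumes "palindromic n p"
  shows "trig 0 p n (- z) = trig 0 p n z"
  unfolding trig_def
  by (rule sum.reindex_bij_witness[of _ "\<lambda>l. n - l" "\<lambda>l. n - l"])
     (use assms in \<open>auto simp: palindromic_def freq_def of_nat_diff algebra_simps\<close>)

text \<open>With real coefficients, conjugation is the reflection z -> -z, which evenness
  undoes.\<close>

lemma trig_real:
  assumes "palindromic n p" "real_coeffs p"
  shows "trig 0 p n z \<in> \<real>"
proof -
  have "cnj (trig 0 p n z) = trig 0 p n (- z)"
    using assms(2) by (simp add: trig_def real_coeffs_def Reals_cnj_iff cis_cnj)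
  thus ?thesis using trig_even[OF assms(1)] by (simp add: Reals_cnj_iff)
qed

lemma trig_periodic: "trig j p n (z + 2 * pi) = trig j p n z"
proof -
  have "cis (of_int m * (z + 2 * pi)) = cis (of_int m * z)" for m
  proof -
    have "cis (of_int m * (z + 2 * pi)) = cis (of_int m * z) * cis (2 * pi * of_int m)"
      unfolding cis_mult by (simp add: algebra_simps)
    thus ?thesis by (simp add: cis_multiple_2pi)
  qed
  thus ?thesis by (simp add: trig_def)
qed

lemma has_derivative_Re_trig:
  "((\<lambda>z. Re (trig j p n z)) has_real_derivative Re (trig (Suc j) p n z)) (at z)"
proof -
  have cis: "((\<lambda>z. cis (m * z)) has_vector_derivative \<i> * m * cis (m * z)) (at z)" for m :: real
  proof -
    have "((\<lambda>z. exp (\<i> * of_real m * of_real z)) has_vector_derivative \<i> * m * exp (\<i> * m * of_real z)) (at z)"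
      by (rule has_vector_derivative_real_field) (auto intro!: derivative_eq_intros)
    thus ?thesis by (simp add: cis_conv_exp mult_ac)
  qed
  have "(trig j p n has_vector_derivative trig (Suc j) p n z) (at z)"
    unfolding trig_def
  proof (rule has_vector_derivative_sum)
    fix l assume "l \<in> {..n}"
    from has_vector_derivative_mult_right[OF cis[of "of_int (freq n l)"], of "coeff p l * (\<i> * of_int (freq n l)) ^ j"]
    show "((\<lambda>x. coeff p l * (\<i> * of_int (freq n l)) ^ j * cis (of_int (freq n l) * x)) has_vector_derivative
         coeff p l * (\<i> * of_int (freq n l)) ^ Suc j * cis (of_int (freq n l) * z)) (at z)"
      by (simp add: mult_ac)
  qed
  from bounded_linear.has_vector_derivative[OF bounded_linear_Re this]
  show ?thesis by (simp add: has_real_derivative_iff_has_vector_derivative)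
qed

section \<open>The Stokes expansion and its majorant\<close>

text \<open>The parameter \<open>b\<close> stands for the response of the linear part and is left
  abstract, so that bounds, symmetry and dependence on \<open>k\<close> can be studied separately.
  The start value encodes cos z. The square and the speed are written out in the recursion because
  they are not yet available as functions; the speed of index i < n uses only entries up to i, which
  gives termination.\<close>

function stokes :: "(int \<Rightarrow> complex) \<Rightarrow> nat \<Rightarrow> complex poly" where
  "stokes b n =
     (if n = 0 then 0 else if n = 1 then [:1/2, 1/2:]
      else \<Sum>l\<le>n. monom (b (freq n l) * coeff
        ((\<Sum>i\<in>{1..<n}. stokes b i * stokes b (n - i)) -
         (\<Sum>i\<in>{1..<n}. smult
            (if even i then 2 * coeff (\<Sum>j\<in>{1..<Suc i}. stokes b j * stokes b (Suc i - j)) (Suc (i div 2)) else 0)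
            (monom 1 (i div 2) * stokes b (n - i)))) l) l)"
  by auto
termination by (relation "Wellfounded.measure snd") auto

declare stokes.simps [simp del]

definition stokes_sq :: "(int \<Rightarrow> complex) \<Rightarrow> nat \<Rightarrow> complex poly" where
  "stokes_sq b n = (\<Sum>i\<in>{1..<n}. stokes b i * stokes b (n - i))"

text \<open>Coefficient i of c - c_0. Index \<open>Suc (i div 2)\<close> at the odd order
  \<open>Suc i\<close> is frequency 1, and the factor 2 cancels the coefficient 1/2 of cos z.
  Frequency 1 does not occur at even orders, hence the 0 for odd i.\<close>

definition stokes_speed :: "(int \<Rightarrow> complex) \<Rightarrow> nat \<Rightarrow> complex" where
  "stokes_speed b i = (if even i then 2 * coeff (stokes_sq b (Suc i)) (Suc (i div 2)) else 0)"

text \<open>Order n of (c - c_0) w. The monomial lifts an entry of order n - i to the encoding of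
  order n; for odd i the rounding in \<open>i div 2\<close> is harmless since the speed coefficient
  is 0.\<close>

definition stokes_drift :: "(int \<Rightarrow> complex) \<Rightarrow> nat \<Rightarrow> complex poly" where
  "stokes_drift b n = (\<Sum>i\<in>{1..<n}. smult (stokes_speed b i) (monom 1 (i div 2) * stokes b (n - i)))"

lemma stokes_0 [simp]: "stokes b 0 = 0"
  by (simp add: stokes.simps)

lemma stokes_1 [simp]: "stokes b (Suc 0) = [:1/2, 1/2:]"
  by (simp add: stokes.simps)

lemma coeff_stokes:
  assumes "n \<ge> 2" "l \<le> n"
  shows "coeff (stokes b n) l = b (freq n l) * coeff (stokes_sq b n - stokes_drift b n) l"
  using assms
  unfolding stokes.simps[of b n] stokes_sq_def[symmetric] stokes_speed_def[symmetric] stokes_drift_def[symmetric]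
  by (simp add: coeff_sum)

lemma degree_stokes: "degree (stokes b n) \<le> n"
proof -
  consider "n = 0" | "n = 1" | "n \<ge> 2" by linarith
  thus ?thesis
  proof cases
    case 3
    thus ?thesis unfolding stokes.simps[of b n]
      by (auto intro!: degree_sum_le order.trans[OF degree_monom_le])
  qed auto
qed

text \<open>The end terms vanish because \<open>stokes b 0 = 0\<close>. The short range serves the
  recursion, the full range is the shape of a Cauchy product.\<close>

lemma stokes_sq_eq: "stokes_sq b n = (\<Sum>i\<le>n. stokes b i * stokes b (n - i))"
  unfolding stokes_sq_def
proof (rule sum.mono_neutral_left)
  have "i = 0 \<or> i = n" if "i \<in> {..n} - {1..<n}" for i using that by auto
  thus "\<forall>i\<in>{..n} - {1..<n}. stokes b i * stokes b (n - i) = 0" by fastforce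
qed auto

lemma stokes_speed_odd: "odd i \<Longrightarrow> stokes_speed b i = 0"
  by (simp add: stokes_speed_def)

lemma stokes_speed_0 [simp]: "stokes_speed b 0 = 0"
  by (simp add: stokes_speed_def stokes_sq_def)

lemma stokes_drift_eq:
  "stokes_drift b n = (\<Sum>i\<le>n. smult (stokes_speed b i) (monom 1 (i div 2) * stokes b (n - i)))"
  unfolding stokes_drift_def
proof (rule sum.mono_neutral_left)
  have "i = 0 \<or> i = n" if "i \<in> {..n} - {1..<n}" for i using that by auto
  thus "\<forall>i\<in>{..n} - {1..<n}. smult (stokes_speed b i) (monom 1 (i div 2) * stokes b (n - i)) = 0"
    by fastforce
qed auto

section \<open>Evenness of the expansion and its dependence on the response\<close>

lemma palindromic_drift_term:
  assumes "palindromic (n - i) (stokes b (n - i))" "i \<le> n"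
  shows "palindromic n (smult (stokes_speed b i) (monom 1 (i div 2) * stokes b (n - i)))"
proof (cases "even i")
  case True
  then obtain t where "i = 2 * t" by (elim evenE)
  thus ?thesis using palindromic_monom_mult[of n t] assms by (simp add: palindromic_smult)
qed (simp add: stokes_speed_odd)

lemma palindromic_stokes:
  assumes "\<And>m. b (- m) = b m"
  shows "palindromic n (stokes b n)"
proof (induction n rule: less_induct)
  case (less n)
  consider "n = 0" | "n = 1" | "n \<ge> 2" by linarith
  thus ?case
  proof cases
    case 2
    thus ?thesis by (auto simp: palindromic_def coeff_pCons le_Suc_eq split: nat.splits)
  next
    case 3
    have sq: "palindromic n (stokes_sq b n)"
      unfolding stokes_sq_def
    proof (rule palindromic_sum)
      fix i assume "i \<in> {1..<n}"
      thus "palindromic n (stokes b i * stokes b (n - i))"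
        using palindromic_mult[OF less[of i] less[of "n - i"]] by simp
    qed
    have drift: "palindromic n (stokes_drift b n)"
      unfolding stokes_drift_def
      by (intro palindromic_sum palindromic_drift_term less) auto
    have "coeff (stokes b n) (n - l) = coeff (stokes b n) l" if "l \<le> n" for l
    proof -
      have "freq n (n - l) = - freq n l" using that by (simp add: freq_def of_nat_diff)
      moreover have "coeff (stokes_sq b n - stokes_drift b n) (n - l) = coeff (stokes_sq b n - stokes_drift b n) l"
        using palindromic_diff[OF sq drift] that by (simp add: palindromic_def)
      ultimately show ?thesis using 3 that by (simp add: coeff_stokes assms)
    qed
    thus ?thesis using degree_stokes by (simp add: palindromic_def)
  qed auto
qed

lemma palindromic_stokes_sq:
  assumes "\<And>m. b (- m) = b m"
  shows "palindromic n (stokes_sq b n)"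
  unfolding stokes_sq_eq
proof (rule palindromic_sum)
  fix i assume "i \<in> {..n}"
  thus "palindromic n (stokes b i * stokes b (n - i))"
    using palindromic_mult[OF palindromic_stokes[of b i, OF assms] palindromic_stokes[of b "n - i", OF assms]]
    by simp
qed

lemma degree_stokes_sq: "degree (stokes_sq b n) \<le> n"
  unfolding stokes_sq_def
proof (rule degree_sum_le)
  fix i assume "i \<in> {1..<n}"
  thus "degree (stokes b i * stokes b (n - i)) \<le> n"
    using degree_mult_le[of "stokes b i" "stokes b (n - i)"] degree_stokes[of b i] degree_stokes[of b "n - i"]
    by (simp add: le_diff_conv2 less_imp_le)
qed auto

text \<open>All entries and speeds are polynomials with real coefficients in the values of the
  response. Any class of functions closed under sums and products that contains the real constants
  and the response therefore contains them. It is applied to real-valuedness and to holomorphy in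
  the wave number.\<close>

lemma stokes_coeff_induct:
  fixes C :: "'a \<Rightarrow> int \<Rightarrow> complex" and A :: "('a \<Rightarrow> complex) \<Rightarrow> bool"
  assumes const: "\<And>c. A (\<lambda>x. of_real c)"
    and add: "\<And>f g. A f \<Longrightarrow> A g \<Longrightarrow> A (\<lambda>x. f x + g x)"
    and mult: "\<And>f g. A f \<Longrightarrow> A g \<Longrightarrow> A (\<lambda>x. f x * g x)"
    and C: "\<And>m. A (\<lambda>x. C x m)"
  shows "A (\<lambda>x. coeff (stokes (C x) n) l)"
    and "A (\<lambda>x. stokes_speed (C x) n)"
proof -
  have sum: "A (\<lambda>x. \<Sum>i\<in>I. f i x)" if "\<And>i. i \<in> I \<Longrightarrow> A (f i)" for I :: "nat set" and f
    using that by (induction I rule: infinite_finite_induct) (use const[of 0] in \<open>auto intro: add\<close>)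
  have sq: "A (\<lambda>x. coeff (stokes_sq (C x) n) l)"
    if "\<And>i l. i < n \<Longrightarrow> A (\<lambda>x. coeff (stokes (C x) i) l)" for n l
    unfolding stokes_sq_def coeff_sum coeff_mult by (intro sum mult that) auto
  have speed: "A (\<lambda>x. stokes_speed (C x) n)"
    if "\<And>i l. i \<le> n \<Longrightarrow> A (\<lambda>x. coeff (stokes (C x) i) l)" for n
    unfolding stokes_speed_def
    using mult[OF const[of 2] sq[of "Suc n" "Suc (n div 2)"]] that const[of 0] by (cases "even n") simp_all
  have stokes: "A (\<lambda>x. coeff (stokes (C x) n) l)" for n l
  proof (induction n arbitrary: l rule: less_induct)
    case (less n)
    consider "n = 0" | "n = 1" | "n \<ge> 2" "l > n" | "n \<ge> 2" "l \<le> n" by linarith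
    thus ?case
    proof cases
      case 1
      thus ?thesis using const[of 0] by simp
    next
      case 2
      \<comment> \<open>\<open>const\<close> offers real constants only, and the coefficients of the
        start value are real, so they equal their real parts.\<close>
      thus ?thesis using const[of "Re (coeff [:1/2, 1/2:] l)"]
        by (simp add: coeff_pCons split: nat.splits)
    next
      case 3
      hence "coeff (stokes (C x) n) l = 0" for x
        using degree_stokes[of "C x" n] by (intro coeff_eq_0) simp
      thus ?thesis using const[of 0] by simp
    next
      case 4
      have "A (\<lambda>x. coeff (stokes_drift (C x) n) l)"
        unfolding stokes_drift_def coeff_sum coeff_smult coeff_mult coeff_monom
      proof (intro sum mult speed)
        fix i t :: nat
        show "A (\<lambda>x. if i = t then 1 else 0)" using const[of 0] const[of 1] by simp
      qed (auto intro: less)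
      hence "A (\<lambda>x. C x (freq n l) * (coeff (stokes_sq (C x) n) l + of_real (-1) * coeff (stokes_drift (C x) n) l))"
        by (intro mult add C sq less const)
      thus ?thesis using 4 by (simp add: coeff_stokes)
    qed
  qed
  show "A (\<lambda>x. coeff (stokes (C x) n) l)" "A (\<lambda>x. stokes_speed (C x) n)"
    by (intro stokes speed)+
qed

lemma stokes_real:
  assumes "\<And>m. b m \<in> \<real>"
  shows "real_coeffs (stokes b n)" "stokes_speed b n \<in> \<real>"
  unfolding real_coeffs_def
  using stokes_coeff_induct[of "\<lambda>f. f () \<in> \<real>" "\<lambda>_. b"] assms by auto

section \<open>Weighted convolution estimates and the majorant bound\<close>

lemma sum_convolution_le:
  fixes f g :: "nat \<Rightarrow> real"
  assumes "\<And>i. f i \<ge> 0" "\<And>i. g i \<ge> 0"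
  shows "(\<Sum>n\<le>Suc N. \<Sum>i\<in>{1..<n}. f i * g (n - i)) \<le> (\<Sum>i\<in>{1..N}. f i) * (\<Sum>i\<in>{1..N}. g i)"
proof -
  have "(\<Sum>n\<le>Suc N. \<Sum>i\<in>{1..<n}. f i * g (n - i)) =
        (\<Sum>(n, i)\<in>Sigma {..Suc N} (\<lambda>n. {1..<n}). f i * g (n - i))"
    by (rule sum.Sigma) auto
  also have "\<dots> = (\<Sum>(i, j)\<in>{(i, j). 1 \<le> i \<and> 1 \<le> j \<and> i + j \<le> Suc N}. f i * g j)"
    by (rule sum.reindex_bij_witness[of _ "\<lambda>(i, j). (i + j, i)" "\<lambda>(n, i). (i, n - i)"]) auto
  \<comment> \<open>Both indices are at least 1 and their sum is at most N + 1, so each is at most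
    N. This gain of one order drives the induction on the order below.\<close>
  also have "\<dots> \<le> (\<Sum>(i, j)\<in>{1..N} \<times> {1..N}. f i * g j)"
    using assms by (intro sum_mono2) (auto split: prod.splits)
  also have "\<dots> = (\<Sum>i\<in>{1..N}. f i) * (\<Sum>i\<in>{1..N}. g i)"
    by (simp add: sum_product sum.cartesian_product)
  finally show ?thesis .
qed

lemma l1_norm_stokes_sq_le:
  "l1_norm (stokes_sq b n) * \<rho> ^ n \<le>
     (\<Sum>i\<in>{1..<n}. (l1_norm (stokes b i) * \<rho> ^ i) * (l1_norm (stokes b (n - i)) * \<rho> ^ (n - i)))"
  if "\<rho> > 0"
proof -
  have "l1_norm (stokes_sq b n) \<le> (\<Sum>i\<in>{1..<n}. l1_norm (stokes b i) * l1_norm (stokes b (n - i)))"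
    unfolding stokes_sq_def by (intro order.trans[OF l1_norm_sum] sum_mono l1_norm_mult)
  hence "l1_norm (stokes_sq b n) * \<rho> ^ n \<le> (\<Sum>i\<in>{1..<n}. l1_norm (stokes b i) * l1_norm (stokes b (n - i))) * \<rho> ^ n"
    using that by (intro mult_right_mono) auto
  also have "\<dots> = (\<Sum>i\<in>{1..<n}. (l1_norm (stokes b i) * \<rho> ^ i) * (l1_norm (stokes b (n - i)) * \<rho> ^ (n - i)))"
    unfolding sum_distrib_right
  proof (rule sum.cong)
    fix i assume "i \<in> {1..<n}"
    hence "\<rho> ^ n = \<rho> ^ i * \<rho> ^ (n - i)" by (simp flip: power_add)
    thus "l1_norm (stokes b i) * l1_norm (stokes b (n - i)) * \<rho> ^ n =
      (l1_norm (stokes b i) * \<rho> ^ i) * (l1_norm (stokes b (n - i)) * \<rho> ^ (n - i))" by simp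
  qed auto
  finally show ?thesis .
qed

lemma l1_norm_stokes_drift_le:
  "l1_norm (stokes_drift b n) * \<rho> ^ n \<le>
     (\<Sum>i\<in>{1..<n}. (norm (stokes_speed b i) * \<rho> ^ i) * (l1_norm (stokes b (n - i)) * \<rho> ^ (n - i)))"
  if "\<rho> > 0"
proof -
  have "l1_norm (stokes_drift b n) \<le> (\<Sum>i\<in>{1..<n}. norm (stokes_speed b i) * l1_norm (stokes b (n - i)))"
    unfolding stokes_drift_def
    by (rule order.trans[OF l1_norm_sum]) (simp add: l1_norm_smult l1_norm_monom_mult)
  hence "l1_norm (stokes_drift b n) * \<rho> ^ n \<le> (\<Sum>i\<in>{1..<n}. norm (stokes_speed b i) * l1_norm (stokes b (n - i))) * \<rho> ^ n"
    using that by (intro mult_right_mono) auto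
  also have "\<dots> = (\<Sum>i\<in>{1..<n}. (norm (stokes_speed b i) * \<rho> ^ i) * (l1_norm (stokes b (n - i)) * \<rho> ^ (n - i)))"
    unfolding sum_distrib_right
  proof (rule sum.cong)
    fix i assume "i \<in> {1..<n}"
    hence "\<rho> ^ n = \<rho> ^ i * \<rho> ^ (n - i)" by (simp flip: power_add)
    thus "norm (stokes_speed b i) * l1_norm (stokes b (n - i)) * \<rho> ^ n =
      (norm (stokes_speed b i) * \<rho> ^ i) * (l1_norm (stokes b (n - i)) * \<rho> ^ (n - i))" by simp
  qed auto
  finally show ?thesis .
qed

lemma l1_norm_stokes_le:
  assumes "\<And>m. norm (b m) \<le> B" "n \<ge> 2"
  shows "l1_norm (stokes b n) \<le> B * (l1_norm (stokes_sq b n) + l1_norm (stokes_drift b n))"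
proof -
  let ?T = "stokes_sq b n - stokes_drift b n"
  have B: "B \<ge> 0" using norm_ge_zero[of "b 0"] assms(1)[of 0] by linarith
  have "l1_norm (stokes b n) = (\<Sum>l\<le>n. norm (b (freq n l)) * norm (coeff ?T l))"
    using assms(2) by (simp add: l1_norm_eq[OF degree_stokes] coeff_stokes norm_mult)
  also have "\<dots> \<le> (\<Sum>l\<le>n. B * norm (coeff ?T l))"
    by (intro sum_mono mult_right_mono assms(1)) auto
  also have "\<dots> = B * (\<Sum>l\<le>n. norm (coeff ?T l))" by (simp add: sum_distrib_left)
  \<comment> \<open>No degree bound for \<open>?T\<close> is used; enlarging the range only adds
    nonnegative terms.\<close>
  also have "(\<Sum>l\<le>n. norm (coeff ?T l)) \<le> (\<Sum>l\<le>max n (degree ?T). norm (coeff ?T l))"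
    by (intro sum_mono2) auto
  also have "\<dots> = l1_norm ?T" by (rule l1_norm_eq[symmetric]) simp
  also have "\<dots> \<le> l1_norm (stokes_sq b n) + l1_norm (stokes_drift b n)" by (rule l1_norm_diff)
  finally show ?thesis using B by (simp add: mult_left_mono)
qed

text \<open>Method of majorants: with \<open>S\<close> the weighted sum of the norms up to order \<open>N\<close>, the recursion bounds
  the sum up to order \<open>N + 1\<close> by \<open>\<rho> + B (S\<^sup>2 + (2 S\<^sup>2 / \<rho>) S)\<close>, and \<open>S \<le> 2 \<rho>\<close> is preserved.\<close>

lemma stokes_majorant:
  assumes b: "\<And>m. norm (b m) \<le> B" and \<rho>: "\<rho> > 0" "20 * B * \<rho> \<le> 1"
  shows "(\<Sum>n\<in>{1..N}. l1_norm (stokes b n) * \<rho> ^ n) \<le> 2 * \<rho>"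
    and "(\<Sum>n\<le>Suc N. l1_norm (stokes_sq b n) * \<rho> ^ n) \<le> 4 * \<rho>\<^sup>2"
    and "(\<Sum>n\<in>{1..N}. norm (stokes_speed b n) * \<rho> ^ n) \<le> 8 * \<rho>"
proof -
  define S where "S N = (\<Sum>n\<in>{1..N}. l1_norm (stokes b n) * \<rho> ^ n)" for N
  have B: "B \<ge> 0" using norm_ge_zero[of "b 0"] b[of 0] by linarith
  have S0: "S N \<ge> 0" for N unfolding S_def using \<rho> by (intro sum_nonneg) auto
  have sq: "(\<Sum>n\<le>Suc N. l1_norm (stokes_sq b n) * \<rho> ^ n) \<le> 4 * \<rho>\<^sup>2" if "S N \<le> 2 * \<rho>" for N
  proof -
    have "(\<Sum>n\<le>Suc N. l1_norm (stokes_sq b n) * \<rho> ^ n) \<le> S N * S N"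
      unfolding S_def using \<rho>(1)
      by (intro order.trans[OF sum_mono sum_convolution_le] l1_norm_stokes_sq_le) auto
    also have "\<dots> \<le> (2 * \<rho>) * (2 * \<rho>)" using that S0 \<rho> by (intro mult_mono) auto
    finally show ?thesis by (simp add: power2_eq_square)
  qed
  have speed: "(\<Sum>n\<in>{1..N}. norm (stokes_speed b n) * \<rho> ^ n) \<le> 8 * \<rho>" if "S N \<le> 2 * \<rho>" for N
  proof -
    \<comment> \<open>The speed at order n is read from the square at order n + 1, which costs one
      factor 1 / \<rho>.\<close>
    have "(\<Sum>n\<in>{1..N}. norm (stokes_speed b n) * \<rho> ^ n) \<le>
          (\<Sum>n\<in>{1..N}. 2 / \<rho> * (l1_norm (stokes_sq b (Suc n)) * \<rho> ^ Suc n))"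
    proof (rule sum_mono)
      fix n
      have "norm (stokes_speed b n) \<le> 2 * l1_norm (stokes_sq b (Suc n))"
        by (simp add: stokes_speed_def norm_mult coeff_le_l1_norm)
      hence "norm (stokes_speed b n) * \<rho> ^ n \<le> 2 * l1_norm (stokes_sq b (Suc n)) * \<rho> ^ n"
        using \<rho> by (intro mult_right_mono) auto
      thus "norm (stokes_speed b n) * \<rho> ^ n \<le> 2 / \<rho> * (l1_norm (stokes_sq b (Suc n)) * \<rho> ^ Suc n)"
        using \<rho> by simp
    qed
    also have "\<dots> = 2 / \<rho> * (\<Sum>n\<in>Suc ` {1..N}. l1_norm (stokes_sq b n) * \<rho> ^ n)"
      by (simp only: sum_distrib_left sum.reindex[OF inj_on_subset[OF inj_Suc subset_UNIV]] o_def)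
    also have "\<dots> \<le> 2 / \<rho> * (\<Sum>n\<le>Suc N. l1_norm (stokes_sq b n) * \<rho> ^ n)"
      using \<rho> by (intro mult_left_mono sum_mono2) auto
    also have "\<dots> \<le> 2 / \<rho> * (4 * \<rho>\<^sup>2)"
      using \<rho> by (intro mult_left_mono sq that) auto
    also have "\<dots> = 8 * \<rho>" using \<rho> by (simp add: power2_eq_square)
    finally show ?thesis .
  qed
  have S: "S N \<le> 2 * \<rho>" for N
  proof (induction N)
    case (Suc N)
    have "(\<Sum>n\<le>Suc N. l1_norm (stokes_drift b n) * \<rho> ^ n) \<le>
          (\<Sum>n\<in>{1..N}. norm (stokes_speed b n) * \<rho> ^ n) * S N"
      unfolding S_def using \<rho>(1)
      by (intro order.trans[OF sum_mono sum_convolution_le] l1_norm_stokes_drift_le) auto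
    also have "\<dots> \<le> (8 * \<rho>) * (2 * \<rho>)"
      using Suc S0 \<rho> by (intro mult_mono speed) auto
    finally have drift: "(\<Sum>n\<le>Suc N. l1_norm (stokes_drift b n) * \<rho> ^ n) \<le> 16 * \<rho>\<^sup>2"
      by (simp add: power2_eq_square)
    have "S (Suc N) = \<rho> + (\<Sum>n\<in>{2..Suc N}. l1_norm (stokes b n) * \<rho> ^ n)"
      unfolding S_def by (subst sum.atLeast_Suc_atMost) (auto simp: l1_norm_pCons numeral_2_eq_2)
    also have "(\<Sum>n\<in>{2..Suc N}. l1_norm (stokes b n) * \<rho> ^ n) \<le>
        (\<Sum>n\<in>{2..Suc N}. B * (l1_norm (stokes_sq b n) + l1_norm (stokes_drift b n)) * \<rho> ^ n)"
      using \<rho> b by (intro sum_mono mult_right_mono l1_norm_stokes_le) auto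
    also have "\<dots> \<le> (\<Sum>n\<le>Suc N. B * (l1_norm (stokes_sq b n) + l1_norm (stokes_drift b n)) * \<rho> ^ n)"
      using \<rho> B by (intro sum_mono2) auto
    also have "\<dots> = B * ((\<Sum>n\<le>Suc N. l1_norm (stokes_sq b n) * \<rho> ^ n) + (\<Sum>n\<le>Suc N. l1_norm (stokes_drift b n) * \<rho> ^ n))"
      by (simp add: sum_distrib_left sum.distrib[symmetric] algebra_simps del: sum.atMost_Suc)
    \<comment> \<open>Here 4 comes from the square, (2 \<rho>)(2 \<rho>), and 16 from the drift, (8
      \<rho>)(2 \<rho>). Their sum is the origin of the 20 in the smallness condition, which makes
      the total at most \<rho>.\<close>
    also have "\<dots> \<le> B * (4 * \<rho>\<^sup>2 + 16 * \<rho>\<^sup>2)"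
      by (intro mult_left_mono add_mono sq Suc drift B)
    also have "\<dots> = (20 * B * \<rho>) * \<rho>" by (simp add: power2_eq_square)
    also have "\<dots> \<le> 1 * \<rho>" using \<rho> by (intro mult_right_mono) auto
    finally show ?case by simp
  qed (use \<rho> in \<open>simp add: S_def\<close>)
  show "(\<Sum>n\<in>{1..N}. l1_norm (stokes b n) * \<rho> ^ n) \<le> 2 * \<rho>" using S[of N] by (simp add: S_def)
  show "(\<Sum>n\<le>Suc N. l1_norm (stokes_sq b n) * \<rho> ^ n) \<le> 4 * \<rho>\<^sup>2"
    "(\<Sum>n\<in>{1..N}. norm (stokes_speed b n) * \<rho> ^ n) \<le> 8 * \<rho>"
    by (intro sq speed S)+
qed

lemma stokes_bounds:
  assumes b: "\<And>m. norm (b m) \<le> B" and \<rho>: "\<rho> > 0" "20 * B * \<rho> \<le> 1"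
  shows "l1_norm (stokes b n) \<le> 2 * \<rho> * (1 / \<rho>) ^ n"
    and "l1_norm (stokes_sq b n) \<le> 4 * \<rho>\<^sup>2 * (1 / \<rho>) ^ n"
    and "norm (stokes_speed b n) \<le> 8 * \<rho> * (1 / \<rho>) ^ n"
proof -
  have *: "x \<le> K * (1 / \<rho>) ^ n" if "x * \<rho> ^ n \<le> K" for x K
    using that \<rho> by (simp add: power_divide field_simps)
  show "l1_norm (stokes b n) \<le> 2 * \<rho> * (1 / \<rho>) ^ n"
  proof (cases "n = 0")
    case False
    have "l1_norm (stokes b n) * \<rho> ^ n \<le> (\<Sum>n\<in>{1..n}. l1_norm (stokes b n) * \<rho> ^ n)"
      using False \<rho> by (intro member_le_sum) auto
    also have "\<dots> \<le> 2 * \<rho>" by (rule stokes_majorant[OF assms])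
    finally show ?thesis by (rule *)
  qed (use \<rho> in auto)
  show "norm (stokes_speed b n) \<le> 8 * \<rho> * (1 / \<rho>) ^ n"
  proof (cases "n = 0")
    case False
    have "norm (stokes_speed b n) * \<rho> ^ n \<le> (\<Sum>n\<in>{1..n}. norm (stokes_speed b n) * \<rho> ^ n)"
      using False \<rho> by (intro member_le_sum[of _ _ "\<lambda>n. norm (stokes_speed b n) * \<rho> ^ n"]) auto
    also have "\<dots> \<le> 8 * \<rho>" by (rule stokes_majorant[OF assms])
    finally show ?thesis by (rule *)
  qed (use \<rho> in auto)
  have "l1_norm (stokes_sq b n) * \<rho> ^ n \<le> (\<Sum>n\<le>Suc n. l1_norm (stokes_sq b n) * \<rho> ^ n)"
    using \<rho> by (intro member_le_sum) auto
  also have "\<dots> \<le> 4 * \<rho>\<^sup>2" by (rule stokes_majorant[OF assms])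
  finally show "l1_norm (stokes_sq b n) \<le> 4 * \<rho>\<^sup>2 * (1 / \<rho>) ^ n" by (rule *)
qed

section \<open>Joint analyticity of parametrised power series\<close>

lemma has_sum_prod_nonneg:
  fixes x y :: "nat \<Rightarrow> real"
  assumes "(x has_sum X) UNIV" "(y has_sum Y) UNIV" "\<And>i. x i \<ge> 0" "\<And>j. y j \<ge> 0"
  shows "((\<lambda>(i, j). x i * y j) has_sum X * Y) (UNIV \<times> UNIV)"
proof -
  have 1: "((\<lambda>j. (\<lambda>(i, j). x i * y j) (i, j)) has_sum x i * Y) UNIV" for i
    using has_sum_cmult_right[OF assms(2), of "x i"] by simp
  have 2: "((\<lambda>i. x i * Y) has_sum X * Y) UNIV"
    by (rule has_sum_cmult_left[OF assms(1)])
  have 3: "(\<lambda>(i, j). x i * y j) summable_on (UNIV \<times> UNIV)"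
    by (rule summable_on_SigmaI[OF 1]) (use 2 assms in \<open>auto simp: summable_on_def\<close>)
  show ?thesis by (rule has_sum_SigmaI[OF 1 2 3])
qed

lemma has_sum_binomial:
  fixes x y :: real
  shows "((\<lambda>i. real (n choose i) * x ^ (n - i) * y ^ i) has_sum (x + y) ^ n) UNIV"
proof -
  have "((\<lambda>i. real (n choose i) * x ^ (n - i) * y ^ i) has_sum (\<Sum>i\<le>n. real (n choose i) * x ^ (n - i) * y ^ i)) {..n}"
    by (rule has_sum_finite) auto
  also have "(\<Sum>i\<le>n. real (n choose i) * x ^ (n - i) * y ^ i) = (x + y) ^ n"
    by (subst add.commute, subst binomial_ring) (auto intro!: sum.cong)
  finally show ?thesis
    by (rule has_sum_cong_neutral[THEN iffD1, rotated -1]) auto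
qed

lemma has_sum_geometric:
  fixes q :: real
  assumes "0 \<le> q" "q < 1"
  shows "((\<lambda>n. q ^ n) has_sum 1 / (1 - q)) UNIV"
  using assms by (intro sums_nonneg_imp_has_sum geometric_sums) auto

text \<open>The Taylor coefficients in the second variable are controlled by Cauchy's inequality in the complex
  domain; recentring in the first variable is the binomial expansion of \<open>(a0 + (a - a0)) ^ n\<close>.\<close>

lemma double_series_expansion:
  fixes G :: "nat \<Rightarrow> real \<Rightarrow> complex \<Rightarrow> complex"
  assumes hol: "\<And>n z. G n z holomorphic_on ball (of_real k1) \<epsilon>"
    and bd: "\<And>n z \<kappa>. \<kappa> \<in> ball (of_real k1) \<epsilon> \<Longrightarrow> norm (G n z \<kappa>) \<le> K * R ^ n"
    and R: "R > 0" and a0: "\<bar>a0\<bar> * R < 1" and k0: "\<bar>k0 - k1\<bar> < \<epsilon>"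
    and F: "\<And>a k z. \<bar>a\<bar> * R < 1 \<Longrightarrow> \<bar>k - k1\<bar> < \<epsilon> \<Longrightarrow>
              F a k z = Re (\<Sum>n. G n z (of_real k) * of_real a ^ n)"
  shows "\<exists>r > 0. \<exists>C :: nat \<Rightarrow> nat \<Rightarrow> real \<Rightarrow> real. \<exists>M :: nat \<Rightarrow> nat \<Rightarrow> real.
       (\<forall>i j z. \<bar>C i j z\<bar> \<le> M i j) \<and>
       (\<forall>a k. (a - a0)^2 + (k - k0)^2 < r^2 \<longrightarrow>
          (\<lambda>(i, j). M i j * \<bar>a - a0\<bar>^i * \<bar>k - k0\<bar>^j) summable_on UNIV \<and>
          (\<forall>z. ((\<lambda>(i, j). C i j z * (a - a0)^i * (k - k0)^j) has_sum F a k z) UNIV))"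
proof -
  \<comment> \<open>Half of the remaining room in each variable: the closed disc of radius
    \<open>e\<close> about \<open>k0\<close> stays in the domain, and |a0| + h stays below 1 /
    R.\<close>
  define e where "e = (\<epsilon> - \<bar>k0 - k1\<bar>) / 2"
  define h where "h = (1 / R - \<bar>a0\<bar>) / 2"
  have e: "e > 0" using k0 by (simp add: e_def)
  have h: "h > 0" using a0 R by (simp add: h_def field_simps)
  have cb: "cball (of_real k0) e \<subseteq> ball (complex_of_real k1) \<epsilon>"
  proof
    fix x :: complex assume "x \<in> cball (of_real k0) e"
    moreover have "dist (complex_of_real k1) (of_real k0) = \<bar>k0 - k1\<bar>"
      by (simp add: dist_real_def abs_minus_commute)
    ultimately have "dist (of_real k1) x \<le> \<bar>k0 - k1\<bar> + e"
      using dist_triangle[of "of_real k1" x "of_real k0"] by simp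
    also have "\<dots> < \<epsilon>" using k0 by (simp add: e_def field_simps)
    finally show "x \<in> ball (of_real k1) \<epsilon>" by simp
  qed
  have "norm (G 0 0 (of_real k0)) \<le> K * R ^ 0" using k0 by (intro bd) (simp add: dist_real_def abs_minus_commute)
  hence K: "K \<ge> 0" using norm_ge_zero[of "G 0 0 (of_real k0)"] by (simp del: norm_ge_zero)
  \<comment> \<open>Real parts of the Taylor coefficients suffice, because the increment k - k0 is
    real.\<close>
  define g where "g n j z = Re ((deriv ^^ j) (G n z) (of_real k0) / fact j)" for n j z
  have g_le: "\<bar>g n j z\<bar> \<le> K * R ^ n / e ^ j" for n j z
  proof -
    have "norm ((deriv ^^ j) (G n z) (of_real k0)) \<le> fact j * (K * R ^ n) / e ^ j"
    proof (rule Cauchy_inequality)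
      show "G n z holomorphic_on ball (of_real k0) e"
        using cb by (intro holomorphic_on_subset[OF hol]) auto
      show "continuous_on (cball (of_real k0) e) (G n z)"
        using cb by (intro holomorphic_on_imp_continuous_on holomorphic_on_subset[OF hol]) auto
      show "norm (G n z x) \<le> K * R ^ n" if "norm (of_real k0 - x) = e" for x
        using that cb by (intro bd) (auto simp: dist_norm)
    qed (use e in auto)
    hence "norm ((deriv ^^ j) (G n z) (of_real k0) / fact j) \<le> K * R ^ n / e ^ j"
      by (simp add: norm_divide field_simps)
    thus ?thesis unfolding g_def using abs_Re_le_cmod order.trans by blast
  qed
  have g_sums: "(\<lambda>j. g n j z * (k - k0) ^ j) sums Re (G n z (of_real k))" if "\<bar>k - k0\<bar> < e" for n z k
  proof -
    have "(\<lambda>j. (deriv ^^ j) (G n z) (of_real k0) / fact j * (of_real k - of_real k0) ^ j) sums G n z (of_real k)"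
    proof (rule holomorphic_power_series)
      show "G n z holomorphic_on ball (of_real k0) e"
        using cb by (intro holomorphic_on_subset[OF hol]) auto
      show "complex_of_real k \<in> ball (of_real k0) e"
        using that by (simp add: dist_real_def abs_minus_commute)
    qed
    hence *: "(\<lambda>j. Re ((deriv ^^ j) (G n z) (of_real k0) / fact j * (of_real k - of_real k0) ^ j)) sums Re (G n z (of_real k))"
      by (rule sums_Re)
    have Re: "Re (x * complex_of_real y) = Re x * y" for x y by simp
    from * show ?thesis
      unfolding g_def of_real_diff[symmetric] of_real_power[symmetric] Re .
  qed
  define m where "m i j n = real (n choose i) * \<bar>a0\<bar> ^ (n - i) * (K * R ^ n / e ^ j)" for i j n
  define c where "c i j n z = real (n choose i) * a0 ^ (n - i) * g n j z" for i j n z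
  have m_nonneg: "m i j n \<ge> 0" for i j n using K R e by (simp add: m_def)
  have c_le: "\<bar>c i j n z\<bar> \<le> m i j n" for i j n z
    unfolding c_def m_def abs_mult power_abs by (intro mult_mono g_le) auto
  \<comment> \<open>Summed over i and j first, the binomial theorem gives (|a0| + |\<delta>|)^n and
    the other factor is geometric in |\<eta>| / e. What is left is geometric in n with ratio (|a0| +
    |\<delta>|) R < 1.\<close>
  have summ: "(\<lambda>(n, i, j). m i j n * \<bar>\<delta>\<bar> ^ i * \<bar>\<eta>\<bar> ^ j) summable_on (UNIV \<times> UNIV)"
    if \<delta>: "\<bar>\<delta>\<bar> < h" and \<eta>: "\<bar>\<eta>\<bar> < e" for \<delta> \<eta>
  proof (rule summable_on_SigmaI)
    let ?q = "(\<bar>a0\<bar> + \<bar>\<delta>\<bar>) * R"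
    have "\<bar>a0\<bar> + \<bar>\<delta>\<bar> < 1 / R" using \<delta> h by (simp add: h_def)
    hence q: "?q < 1" using R by (simp add: field_simps)
    show "((\<lambda>p. (\<lambda>(n, i, j). m i j n * \<bar>\<delta>\<bar> ^ i * \<bar>\<eta>\<bar> ^ j) (n, p)) has_sum
            ((\<bar>a0\<bar> + \<bar>\<delta>\<bar>) ^ n * (K * R ^ n * (1 / (1 - \<bar>\<eta>\<bar> / e))))) UNIV" for n
    proof -
      have "((\<lambda>j. K * R ^ n * (\<bar>\<eta>\<bar> / e) ^ j) has_sum (K * R ^ n * (1 / (1 - \<bar>\<eta>\<bar> / e)))) UNIV"
        using \<eta> e by (intro has_sum_cmult_right has_sum_geometric) auto
      from has_sum_prod_nonneg[OF has_sum_binomial[of n "\<bar>a0\<bar>" "\<bar>\<delta>\<bar>"] this] K R e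
      show ?thesis by (simp add: m_def case_prod_unfold power_divide mult_ac)
    qed
    have "(\<lambda>n. ?q ^ n) summable_on UNIV"
      using has_sum_geometric[of ?q] q R by (auto simp: summable_on_def)
    hence "(\<lambda>n. K * (1 / (1 - \<bar>\<eta>\<bar> / e)) * ?q ^ n) summable_on UNIV"
      by (rule summable_on_cmult_right)
    thus "(\<lambda>n. (\<bar>a0\<bar> + \<bar>\<delta>\<bar>) ^ n * (K * R ^ n * (1 / (1 - \<bar>\<eta>\<bar> / e)))) summable_on UNIV"
      by (simp add: power_mult_distrib mult_ac)
  qed (use m_nonneg in auto)
  \<comment> \<open>With n innermost, the inner sums are the coefficients of the double series in
    the increments.\<close>
  hence summ': "(\<lambda>(p, n). (\<lambda>(i, j). m i j n * \<bar>\<delta>\<bar> ^ i * \<bar>\<eta>\<bar> ^ j) p) summable_on (UNIV \<times> UNIV)"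
    if "\<bar>\<delta>\<bar> < h" "\<bar>\<eta>\<bar> < e" for \<delta> \<eta>
    using that by (subst summable_on_swap) (simp add: case_prod_unfold)
  define M where "M i j = (\<Sum>\<^sub>\<infinity>n. m i j n)" for i j
  define C where "C i j z = (\<Sum>\<^sub>\<infinity>n. c i j n z)" for i j z
  have m_summable: "m i j summable_on UNIV" for i j
  proof -
    \<comment> \<open>Any nonzero increments inside the region would do: their powers form a
      positive constant factor that is then cancelled.\<close>
    have "(\<lambda>n. (\<lambda>(i, j). m i j n * \<bar>h/2\<bar> ^ i * \<bar>e/2\<bar> ^ j) (i, j)) summable_on UNIV"
      by (rule summable_on_SigmaD1[OF summ']) (use h e in auto)
    hence "(\<lambda>n. m i j n * (\<bar>h/2\<bar> ^ i * \<bar>e/2\<bar> ^ j)) summable_on UNIV"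
      by (simp add: mult_ac)
    thus ?thesis using h e by (subst (asm) summable_on_cmult_left') auto
  qed
  have C_le: "\<bar>C i j z\<bar> \<le> M i j" for i j z
  proof -
    have "(\<lambda>n. norm (c i j n z)) summable_on UNIV"
      by (rule Infinite_Sum.abs_summable_on_comparison_test'[OF m_summable[of i j]]) (simp add: c_le)
    hence "(\<lambda>n. c i j n z) summable_on UNIV" by (rule abs_summable_summable)
    hence "norm (C i j z) \<le> M i j" unfolding C_def M_def
      by (rule norm_infsum_le[OF has_sum_infsum has_sum_infsum[OF m_summable[of i j]]]) (simp add: c_le)
    thus ?thesis by simp
  qed
  define r where "r = min h e"
  have r: "r > 0" using h e by (simp add: r_def)
  have main: "(\<lambda>(i, j). M i j * \<bar>a - a0\<bar>^i * \<bar>k - k0\<bar>^j) summable_on UNIV \<and>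
          (\<forall>z. ((\<lambda>(i, j). C i j z * (a - a0)^i * (k - k0)^j) has_sum F a k z) UNIV)"
    if ak: "(a - a0)^2 + (k - k0)^2 < r^2" for a k
  proof -
    define \<delta> \<eta> where "\<delta> = a - a0" and "\<eta> = k - k0"
    have "\<delta>\<^sup>2 < r\<^sup>2" "\<eta>\<^sup>2 < r\<^sup>2"
      using ak zero_le_power2[of \<delta>] zero_le_power2[of \<eta>] unfolding \<delta>_def \<eta>_def by linarith+
    hence "\<bar>\<delta>\<bar> < r" "\<bar>\<eta>\<bar> < r" using r by (auto intro: power2_less_imp_less)
    hence \<delta>: "\<bar>\<delta>\<bar> < h" and \<eta>: "\<bar>\<eta>\<bar> < e" by (auto simp: r_def)
    note S = summ'[OF \<delta> \<eta>]
    have "(\<lambda>p. \<Sum>\<^sub>\<infinity>n. (\<lambda>(i, j). m i j n * \<bar>\<delta>\<bar> ^ i * \<bar>\<eta>\<bar> ^ j) p) summable_on UNIV"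
      using summable_on_Sigma_banach[OF S] by simp
    also have "(\<lambda>p. \<Sum>\<^sub>\<infinity>n. (\<lambda>(i, j). m i j n * \<bar>\<delta>\<bar> ^ i * \<bar>\<eta>\<bar> ^ j) p) =
        (\<lambda>(i, j). M i j * \<bar>\<delta>\<bar> ^ i * \<bar>\<eta>\<bar> ^ j)"
      by (auto simp: fun_eq_iff M_def infsum_cmult_left' mult.assoc)
    finally have 1: "(\<lambda>(i, j). M i j * \<bar>\<delta>\<bar> ^ i * \<bar>\<eta>\<bar> ^ j) summable_on UNIV" .
    have 2: "((\<lambda>(i, j). C i j z * \<delta> ^ i * \<eta> ^ j) has_sum F a k z) UNIV" for z
    proof -
      define f where "f = (\<lambda>(p, n). (\<lambda>(i, j). c i j n z * \<delta> ^ i * \<eta> ^ j) p)"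
      define f' where "f' = (\<lambda>(n, p). (\<lambda>(i, j). c i j n z * \<delta> ^ i * \<eta> ^ j) p)"
      have f_sum: "f summable_on (UNIV \<times> UNIV)"
      proof (rule abs_summable_summable, rule Infinite_Sum.abs_summable_on_comparison_test'[OF S])
        show "norm (f p) \<le> (\<lambda>(p, n). (\<lambda>(i, j). m i j n * \<bar>\<delta>\<bar> ^ i * \<bar>\<eta>\<bar> ^ j) p) p" for p
          using c_le
          by (auto simp: f_def case_prod_unfold abs_mult power_abs intro!: mult_right_mono)
      qed
      define T where "T = infsum f (UNIV \<times> UNIV)"
      have fT: "(f has_sum T) (UNIV \<times> UNIV)" unfolding T_def by (rule has_sum_infsum[OF f_sum])
      have "((\<lambda>p. \<Sum>\<^sub>\<infinity>n. f (p, n)) has_sum T) UNIV"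
      proof (rule has_sum_SigmaD[OF fT])
        fix p :: "nat \<times> nat"
        have "(\<lambda>n. f (p, n)) summable_on UNIV"
          using summable_on_SigmaD1[of "\<lambda>p n. f (p, n)" UNIV "\<lambda>_. UNIV" p] f_sum by simp
        thus "((\<lambda>n. f (p, n)) has_sum (\<Sum>\<^sub>\<infinity>n. f (p, n))) UNIV" by (rule has_sum_infsum)
      qed
      also have "(\<lambda>p. \<Sum>\<^sub>\<infinity>n. f (p, n)) = (\<lambda>(i, j). C i j z * \<delta> ^ i * \<eta> ^ j)"
        by (auto simp: fun_eq_iff f_def C_def infsum_cmult_left' mult.assoc)
      finally have CT: "((\<lambda>(i, j). C i j z * \<delta> ^ i * \<eta> ^ j) has_sum T) UNIV" .
      have f'T: "(f' has_sum T) (UNIV \<times> UNIV)"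
        using fT by (subst (asm) has_sum_swap) (simp add: f_def f'_def case_prod_unfold)
      \<comment> \<open>Summing the same absolutely convergent triple series in the other order
        restores the power series in \<open>a\<close>, which identifies the total
        \<open>T\<close>.\<close>
      have "((\<lambda>n. a ^ n * Re (G n z (of_real k))) has_sum T) UNIV"
      proof (rule has_sum_SigmaD[OF f'T])
        fix n :: nat
        have gle: "\<bar>g n j z * \<eta> ^ j\<bar> \<le> K * R ^ n * (\<bar>\<eta>\<bar> / e) ^ j" for j
          using mult_right_mono[OF g_le[of n j z], of "\<bar>\<eta>\<bar> ^ j"] by (simp add: abs_mult power_abs power_divide)
        have "summable (\<lambda>j. K * R ^ n * (\<bar>\<eta>\<bar> / e) ^ j)"
          using \<eta> e by (intro summable_mult summable_geometric) auto
        from summable_comparison_test'[OF this, of 0 "\<lambda>j. norm (g n j z * \<eta> ^ j)"] gle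
        have "summable (\<lambda>j. norm (g n j z * \<eta> ^ j))" by simp
        from norm_summable_imp_has_sum[OF this] g_sums[of k n z] \<eta>
        have gs: "((\<lambda>j. g n j z * \<eta> ^ j) has_sum Re (G n z (of_real k))) UNIV" by (simp add: \<eta>_def)
        show "((\<lambda>p. f' (n, p)) has_sum a ^ n * Re (G n z (of_real k))) UNIV"
        proof -
          have "((\<lambda>p. f' (n, p)) has_sum a ^ n * Re (G n z (of_real k))) (UNIV \<times> UNIV)"
          proof (rule has_sum_SigmaI)
            show "((\<lambda>j. f' (n, i, j)) has_sum real (n choose i) * a0 ^ (n - i) * \<delta> ^ i * Re (G n z (of_real k))) UNIV" for i
              using has_sum_cmult_right[OF gs, of "real (n choose i) * a0 ^ (n - i) * \<delta> ^ i"]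
              by (simp add: f'_def c_def mult_ac)
            show "((\<lambda>i. real (n choose i) * a0 ^ (n - i) * \<delta> ^ i * Re (G n z (of_real k))) has_sum a ^ n * Re (G n z (of_real k))) UNIV"
              using has_sum_cmult_left[OF has_sum_binomial[of n a0 \<delta>], of "Re (G n z (of_real k))"]
              by (simp add: \<delta>_def)
            have "f' summable_on (UNIV \<times> UNIV)" using f'T by (auto simp: summable_on_def)
            thus "(\<lambda>p. f' (n, p)) summable_on UNIV \<times> UNIV"
              using summable_on_SigmaD1[of "\<lambda>n p. f' (n, p)" UNIV "\<lambda>_. UNIV" n] by simp
          qed
          thus ?thesis by simp
        qed
      qed
      hence sumsT: "(\<lambda>n. a ^ n * Re (G n z (of_real k))) sums T" by (rule has_sum_imp_sums)
      have "\<bar>a\<bar> \<le> \<bar>a0\<bar> + \<bar>\<delta>\<bar>" unfolding \<delta>_def by linarith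
      also have "\<dots> < 1 / R" using \<delta> h by (simp add: h_def)
      finally have aR: "\<bar>a\<bar> * R < 1" using R by (simp add: field_simps)
      have "2 * e = \<epsilon> - \<bar>k0 - k1\<bar>" by (simp add: e_def)
      hence kk: "\<bar>k - k1\<bar> < \<epsilon>" using \<eta> e unfolding \<eta>_def by linarith
      have kin: "complex_of_real k \<in> ball (of_real k1) \<epsilon>"
        using kk by (simp add: dist_real_def abs_minus_commute)
      have "summable (\<lambda>n. G n z (of_real k) * of_real a ^ n)"
      proof (rule summable_comparison_test)
        show "summable (\<lambda>n. K * (\<bar>a\<bar> * R) ^ n)"
          using aR R by (intro summable_mult summable_geometric) auto
        have "norm (G n z (of_real k) * of_real a ^ n) \<le> K * R ^ n * \<bar>a\<bar> ^ n" for n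
          using bd[OF kin] by (simp add: norm_mult norm_power mult_right_mono)
        thus "\<exists>N. \<forall>n\<ge>N. norm (G n z (of_real k) * of_real a ^ n) \<le> K * (\<bar>a\<bar> * R) ^ n"
          by (simp add: power_mult_distrib mult_ac)
      qed
      from sums_Re[OF summable_sums[OF this]]
      have "(\<lambda>n. a ^ n * Re (G n z (of_real k))) sums F a k z"
        unfolding F[OF aR kk] by (simp add: mult.commute flip: of_real_power)
      with sumsT have "T = F a k z" by (rule sums_unique2)
      with CT show ?thesis by simp
    qed
    show ?thesis using 1 2 by (simp add: \<delta>_def \<eta>_def)
  qed
  show ?thesis
  proof (intro exI[of _ r] exI[of _ C] exI[of _ M] conjI[OF r] conjI[OF _ allI[OF allI[OF impI]]])
    show "\<forall>i j z. \<bar>C i j z\<bar> \<le> M i j" by (intro allI C_le)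
  qed (rule main)
qed

section \<open>Convergent trigonometric expansions\<close>

text \<open>From (n/j)^j \<le> (1 + n/j)^j \<le> e^n. The polynomial growth caused by j derivatives
  thus costs a constant and a tripled ratio, the same ratio for every j.\<close>

lemma power_le_three_power: "real n ^ j \<le> real j ^ j * 3 ^ n"
proof (cases "j = 0")
  case False
  have "(real n / real j) ^ j \<le> (1 + real n / real j) ^ j"
    by (intro power_mono) auto
  also have "\<dots> \<le> exp (real n)"
    using False by (intro exp_ge_one_plus_x_over_n_power_n) auto
  also have "\<dots> = exp 1 ^ n" using exp_of_nat_mult[of n "1::real"] by simp
  also have "\<dots> \<le> 3 ^ n" by (intro power_mono exp_le) auto
  finally show ?thesis using False by (simp add: power_divide field_simps)
qed auto

text \<open>At half the radius the ratio is at most 1/2, so the tail is at most twice the bound for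
  its first term.\<close>

lemma power_series_tail:
  fixes g :: "nat \<Rightarrow> complex"
  assumes g: "\<And>n. norm (g n) \<le> K * R ^ n" and R: "R \<ge> 0" and a: "\<bar>a\<bar> * R \<le> 1 / 2"
  shows "norm ((\<Sum>n. g n * of_real a ^ n) - (\<Sum>n<N. g n * of_real a ^ n)) \<le> 2 * K * R ^ N * \<bar>a\<bar> ^ N"
proof -
  have K: "K \<ge> 0" using order.trans[OF norm_ge_zero g[of 0]] by simp
  have bd: "norm (g n * of_real a ^ n) \<le> K * (\<bar>a\<bar> * R) ^ n" for n
    using mult_right_mono[OF g[of n], of "\<bar>a\<bar> ^ n"] by (simp add: norm_mult norm_power power_mult_distrib mult_ac)
  have geo: "summable (\<lambda>n. K * (\<bar>a\<bar> * R) ^ n)"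
    using a R by (intro summable_mult summable_geometric) auto
  have summ: "summable (\<lambda>n. g n * of_real a ^ n)"
    by (rule summable_comparison_test'[OF geo, of 0]) (use bd in auto)
  have bd': "norm (g (n + N) * of_real a ^ (n + N)) \<le> K * (\<bar>a\<bar> * R) ^ N * (1/2) ^ n" for n
  proof -
    have "norm (g (n + N) * of_real a ^ (n + N)) \<le> K * (\<bar>a\<bar> * R) ^ N * (\<bar>a\<bar> * R) ^ n"
      using bd[of "n + N"] by (simp add: power_add mult_ac)
    also have "\<dots> \<le> K * (\<bar>a\<bar> * R) ^ N * (1/2) ^ n"
      using a R K by (intro mult_left_mono power_mono) auto
    finally show ?thesis .
  qed
  have geo': "(\<lambda>n. K * (\<bar>a\<bar> * R) ^ N * (1/2) ^ n) sums (K * (\<bar>a\<bar> * R) ^ N * 2)"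
    using sums_mult[OF geometric_sums[of "1/2::real"], of "K * (\<bar>a\<bar> * R) ^ N"] by simp
  have "(\<Sum>n. g n * of_real a ^ n) - (\<Sum>n<N. g n * of_real a ^ n) = (\<Sum>n. g (n + N) * of_real a ^ (n + N))"
    using suminf_split_initial_segment[OF summ, of N] by simp
  also have "norm \<dots> \<le> (\<Sum>n. K * (\<bar>a\<bar> * R) ^ N * (1/2) ^ n)"
    by (rule norm_suminf_le) (use bd' geo' in \<open>auto simp: sums_iff\<close>)
  also have "\<dots> = K * (\<bar>a\<bar> * R) ^ N * 2" using geo' by (simp add: sums_iff)
  finally show ?thesis by (simp add: power_mult_distrib mult_ac)
qed

definition trig_series :: "nat \<Rightarrow> (nat \<Rightarrow> complex poly) \<Rightarrow> real \<Rightarrow> real \<Rightarrow> complex" where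
  "trig_series j T a z = (\<Sum>n. trig j (T n) n z * of_real a ^ n)"

text \<open>The 3 in the smallness condition is the base of the exponential that absorbs derivatives
  in \<open>z\<close>.\<close>

locale convergent_expansion =
  fixes T :: "nat \<Rightarrow> complex poly" and K R a :: real
  assumes degree_T: "degree (T n) \<le> n"
    and l1_norm_T: "l1_norm (T n) \<le> K * R ^ n"
    and R_pos: "R > 0" and a_small: "\<bar>a\<bar> * (3 * R) < 1"
begin

lemma norm_trig_T: "norm (trig j (T n) n z) \<le> real j ^ j * K * (3 * R) ^ n"
proof -
  have "norm (trig j (T n) n z) \<le> real n ^ j * l1_norm (T n)"
    by (rule norm_trig_le[OF degree_T])
  also have "\<dots> \<le> (real j ^ j * 3 ^ n) * (K * R ^ n)"
    by (intro mult_mono power_le_three_power l1_norm_T) auto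
  finally show ?thesis by (simp add: power_mult_distrib mult_ac)
qed

lemma norm_trig_term: "norm (trig j (T n) n z * of_real a ^ n) \<le> real j ^ j * K * (\<bar>a\<bar> * (3 * R)) ^ n"
  using mult_right_mono[OF norm_trig_T[of j n z], of "\<bar>a\<bar> ^ n"]
  by (simp add: norm_mult norm_power power_mult_distrib mult_ac)

lemma summable_majorant: "summable (\<lambda>n. real j ^ j * K * (\<bar>a\<bar> * (3 * R)) ^ n)"
  using a_small R_pos by (intro summable_mult summable_geometric) auto

lemma summable_norm_trig: "summable (\<lambda>n. norm (trig j (T n) n z * of_real a ^ n))"
  by (rule summable_comparison_test'[OF summable_majorant[of j], of 0]) (simp add: norm_trig_term del: norm_mult)

lemma trig_series_sums: "(\<lambda>n. trig j (T n) n z * of_real a ^ n) sums trig_series j T a z"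
  unfolding trig_series_def by (rule summable_sums[OF summable_norm_cancel[OF summable_norm_trig]])

lemma Re_trig_series: "Re (trig_series j T a z) = (\<Sum>n. Re (trig j (T n) n z) * a ^ n)"
  using sums_Re[OF trig_series_sums[of j z]] by (simp add: sums_iff flip: of_real_power)

lemma has_derivative_trig_series:
  "((\<lambda>z. Re (trig_series j T a z)) has_real_derivative Re (trig_series (Suc j) T a z)) (at z)"
  unfolding Re_trig_series
proof (rule has_field_derivative_series'(2)[of UNIV])
  show "((\<lambda>z. Re (trig j (T n) n z) * a ^ n) has_real_derivative Re (trig (Suc j) (T n) n z) * a ^ n) (at z within UNIV)" for n z
    by (intro DERIV_cmult_right has_derivative_Re_trig)
  have Re_le: "norm (Re (trig j (T n) n z) * a ^ n) \<le> real j ^ j * K * (\<bar>a\<bar> * (3 * R)) ^ n" for j n z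
  proof -
    have "norm (Re (trig j (T n) n z * of_real a ^ n)) \<le> norm (trig j (T n) n z * of_real a ^ n)"
      unfolding real_norm_def by (rule abs_Re_le_cmod)
    thus ?thesis using norm_trig_term[of j n z] by (simp flip: of_real_power)
  qed
  show "uniformly_convergent_on UNIV (\<lambda>n z. \<Sum>i<n. Re (trig (Suc j) (T i) i z) * a ^ i)"
    by (rule Weierstrass_m_test'[OF Re_le summable_majorant])
  show "summable (\<lambda>n. Re (trig j (T n) n 0) * a ^ n)"
    by (rule summable_comparison_test'[OF summable_majorant, of 0]) (rule Re_le)
qed auto

lemma dz_trig_series: "dz i (\<lambda>z. Re (trig_series 0 T a z)) = (\<lambda>z. Re (trig_series i T a z))"
proof (induction i)
  case (Suc i)
  have "dz (Suc i) (\<lambda>z. Re (trig_series 0 T a z)) = deriv (\<lambda>z. Re (trig_series i T a z))"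
    using Suc by (simp add: dz_def)
  also have "\<dots> = (\<lambda>z. Re (trig_series (Suc i) T a z))"
    by (intro ext DERIV_imp_deriv has_derivative_trig_series)
  finally show ?case .
qed (simp add: dz_def)

lemma smooth_trig_series: "smooth_fun (\<lambda>z. Re (trig_series 0 T a z))"
  unfolding smooth_fun_def dz_trig_series real_differentiable_def
  using has_derivative_trig_series by blast

lemma trig_series_real:
  assumes "\<And>n. palindromic n (T n)" "\<And>n. real_coeffs (T n)"
  shows "trig_series 0 T a z \<in> \<real>"
proof -
  have "trig 0 (T n) n z \<in> \<real>" for n
    by (rule trig_real[OF assms])
  hence Im: "Im (trig 0 (T n) n z * of_real a ^ n) = 0" for n
    by (simp add: complex_is_Real_iff flip: of_real_power)
  have "(\<lambda>n. Im (trig 0 (T n) n z * of_real a ^ n)) sums Im (trig_series 0 T a z)"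
    by (rule sums_Im[OF trig_series_sums])
  hence "Im (trig_series 0 T a z) = 0" unfolding Im using sums_unique2 sums_zero by metis
  thus ?thesis by (simp add: complex_is_Real_iff)
qed

end

section \<open>The equation at each order\<close>

text \<open>The factor by which the linearisation about zero maps the forcing at frequency \<open>m\<close> to the response.
  Division by zero makes it vanish at \<open>m = 1\<close> and \<open>m = -1\<close>, which selects the solution whose first
  Fourier mode is exactly \<open>a cos z\<close>.\<close>

definition response :: "real \<Rightarrow> real \<Rightarrow> complex \<Rightarrow> int \<Rightarrow> complex" where
  "response \<gamma> \<beta> \<kappa> m =
     \<kappa>\<^sup>2 * of_int m ^ 2 / ((of_int m ^ 2 - 1) * (of_real \<gamma> - of_real \<beta> * \<kappa> ^ 4 * of_int m ^ 2))"

lemma response_minus [simp]: "response \<gamma> \<beta> \<kappa> (- m) = response \<gamma> \<beta> \<kappa> m"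
  by (simp add: response_def)

lemma response_0 [simp]: "response \<gamma> \<beta> \<kappa> 0 = 0" and response_1 [simp]: "response \<gamma> \<beta> \<kappa> 1 = 0"
  by (simp_all add: response_def)

lemma response_real: "response \<gamma> \<beta> (of_real k) m \<in> \<real>"
  unfolding response_def by (intro Reals_divide Reals_mult Reals_diff Reals_power) auto

text \<open>At frequency \<open>1\<close> all drift terms vanish except the one with the leading mode, and the speed
  coefficient is chosen to balance it against the square.\<close>

lemma stokes_solvability:
  assumes b1: "b 1 = 0" and n: "n \<ge> 2" "n = 2 * t + 1"
  shows "coeff (stokes_drift b n) (Suc t) = coeff (stokes_sq b n) (Suc t)"
proof -
  have "coeff (stokes_drift b n) (Suc t) =
      (\<Sum>i\<in>{1..<n}. stokes_speed b i * coeff (monom 1 (i div 2) * stokes b (n - i)) (Suc t))"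
    by (simp add: stokes_drift_def coeff_sum)
  also have "\<dots> = (\<Sum>i\<in>{2 * t}. stokes_speed b i * coeff (monom 1 (i div 2) * stokes b (n - i)) (Suc t))"
  proof (rule sum.mono_neutral_right)
    show "\<forall>i\<in>{1..<n} - {2 * t}. stokes_speed b i * coeff (monom 1 (i div 2) * stokes b (n - i)) (Suc t) = 0"
    proof
      fix i assume i: "i \<in> {1..<n} - {2 * t}"
      show "stokes_speed b i * coeff (monom 1 (i div 2) * stokes b (n - i)) (Suc t) = 0"
      proof (cases "even i")
        case True
        then obtain s where s: "i = 2 * s" by (elim evenE)
        have "s < t" using i n s by auto
        hence "freq (n - i) (Suc t - s) = 1" "n - i \<ge> 2" "Suc t - s \<le> n - i"
          using s n by (auto simp: freq_def of_nat_diff)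
        hence "coeff (stokes b (n - i)) (Suc t - s) = 0" by (simp add: coeff_stokes b1)
        thus ?thesis using s by (simp add: coeff_monom_mult)
      qed (simp add: stokes_speed_odd)
    qed
  qed (use n in auto)
  \<comment> \<open>The surviving term pairs the speed of order 2 t with cos z, whose coefficient
    1/2 cancels the 2 in \<open>stokes_speed\<close>.\<close>
  also have "\<dots> = coeff (stokes_sq b n) (Suc t)"
    using n by (simp add: coeff_monom_mult stokes_speed_def)
  finally show ?thesis .
qed

lemma palindromic_stokes_drift:
  assumes "\<And>m. b (- m) = b m"
  shows "palindromic n (stokes_drift b n)"
  unfolding stokes_drift_def
proof (rule palindromic_sum, rule palindromic_drift_term)
  show "palindromic (n - i) (stokes b (n - i))" for i
    by (rule palindromic_stokes) (rule assms)
qed auto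

text \<open>In product form the identity also covers the kernel. At m = 1 and m = -1 both sides
  vanish by solvability, at m = 0 because the forcing carries the factor m^2, and elsewhere the
  denominator of the response is cleared.\<close>

lemma stokes_mode_equation:
  fixes \<gamma> \<beta> :: real and \<kappa> :: complex
  defines "b \<equiv> response \<gamma> \<beta> \<kappa>"
  assumes nonres: "\<And>m::int. \<bar>m\<bar> \<ge> 2 \<Longrightarrow> of_real \<gamma> - of_real \<beta> * \<kappa> ^ 4 * of_int m ^ 2 \<noteq> (0::complex)"
    and l: "l \<le> n"
  defines "m \<equiv> complex_of_int (freq n l)"
  shows "(m ^ 2 - 1) * (of_real \<gamma> - of_real \<beta> * \<kappa> ^ 4 * m ^ 2) * coeff (stokes b n) l =
         \<kappa>\<^sup>2 * m ^ 2 * (coeff (stokes_sq b n) l - coeff (stokes_drift b n) l)"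
proof -
  have even: "b (- m) = b m" for m by (simp add: b_def)
  consider "n = 0" | "n = 1" | "n \<ge> 2" "freq n l = 0" | "n \<ge> 2" "\<bar>freq n l\<bar> = 1" | "n \<ge> 2" "\<bar>freq n l\<bar> \<ge> 2"
    by linarith
  thus ?thesis
  proof cases
    case 1
    thus ?thesis by (simp add: stokes_sq_def stokes_drift_def)
  next
    case 2
    have "l = 0 \<or> l = 1" using l 2 by auto
    hence "m ^ 2 = 1" using 2 by (auto simp: m_def freq_def)
    thus ?thesis using 2 by (simp add: stokes_sq_def stokes_drift_def)
  next
    case 3
    thus ?thesis using l by (simp add: coeff_stokes m_def b_def)
  next
    case 4
    have pm: "freq n l = 1 \<or> freq n l = - 1" using 4(2) by linarith
    hence "odd (freq n l)" by (elim disjE) simp_all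
    hence "odd n" by (simp add: freq_def)
    then obtain t where t: "n = 2 * t + 1" by (elim oddE)
    have sol: "coeff (stokes_drift b n) (Suc t) = coeff (stokes_sq b n) (Suc t)"
      using stokes_solvability[of b n t, OF _ 4(1) t] by (simp add: b_def)
    \<comment> \<open>Frequency -1 sits at \<open>n - Suc t\<close>; solvability is transferred to
      it by evenness.\<close>
    have "l = Suc t \<or> l = n - Suc t" using pm unfolding freq_def t by linarith
    moreover have "coeff (stokes_drift b n) (n - Suc t) = coeff (stokes_drift b n) (Suc t)"
      "coeff (stokes_sq b n) (n - Suc t) = coeff (stokes_sq b n) (Suc t)"
      by (rule palindromicD, rule palindromic_stokes_drift palindromic_stokes_sq, rule even, simp add: t)+
    ultimately have "coeff (stokes_drift b n) l = coeff (stokes_sq b n) l"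
      using sol by metis
    moreover have "m ^ 2 = 1"
      using pm unfolding m_def by (elim disjE) simp_all
    ultimately show ?thesis by simp
  next
    case 5
    have "m ^ 2 \<noteq> 1"
    proof
      assume "m ^ 2 = 1"
      hence "of_int (freq n l ^ 2) = (of_int 1 :: complex)" by (simp add: m_def)
      hence "freq n l ^ 2 = 1" using of_int_eq_iff by blast
      hence "freq n l = 1 \<or> freq n l = - 1" by (simp only: power2_eq_1_iff)
      with 5(2) show False by (elim disjE) simp_all
    qed
    moreover have "of_real \<gamma> - of_real \<beta> * \<kappa> ^ 4 * m ^ 2 \<noteq> 0"
      using nonres[OF 5(2)] by (simp add: m_def)
    ultimately show ?thesis
      using 5 l by (simp add: coeff_stokes b_def response_def flip: m_def)
  qed
qed

text \<open>The factor \<open>of_real \<gamma> + of_real \<beta> * \<kappa> ^ 4\<close> is k^2 c_0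
  at complex \<open>k\<close>; the corrections of the speed are all in the drift term.\<close>

lemma trig_stokes_equation:
  fixes \<gamma> \<beta> :: real and \<kappa> :: complex
  defines "b \<equiv> response \<gamma> \<beta> \<kappa>"
  assumes nonres: "\<And>m::int. \<bar>m\<bar> \<ge> 2 \<Longrightarrow> of_real \<gamma> - of_real \<beta> * \<kappa> ^ 4 * of_int m ^ 2 \<noteq> (0::complex)"
  shows "(of_real \<gamma> + of_real \<beta> * \<kappa> ^ 4) * trig 2 (stokes b n) n z + \<kappa>\<^sup>2 * trig 2 (stokes_drift b n) n z +
         of_real \<beta> * \<kappa> ^ 4 * trig 4 (stokes b n) n z - \<kappa>\<^sup>2 * trig 2 (stokes_sq b n) n z +
         of_real \<gamma> * trig 0 (stokes b n) n z = 0"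
proof -
  have mode: "(of_real \<gamma> + of_real \<beta> * \<kappa> ^ 4) * (p * (\<i> * m) ^ 2 * e) + \<kappa>\<^sup>2 * (d * (\<i> * m) ^ 2 * e) +
         of_real \<beta> * \<kappa> ^ 4 * (p * (\<i> * m) ^ 4 * e) - \<kappa>\<^sup>2 * (q * (\<i> * m) ^ 2 * e) +
         of_real \<gamma> * (p * (\<i> * m) ^ 0 * e) = 0"
    if "(m ^ 2 - 1) * (of_real \<gamma> - of_real \<beta> * \<kappa> ^ 4 * m ^ 2) * p = \<kappa>\<^sup>2 * m ^ 2 * (q - d)"
    for p q d m e :: complex
  proof -
    have i4: "(\<i> * m) ^ 4 = m ^ 2 * m ^ 2" "(\<i> * m) ^ 2 = - (m ^ 2)"
      by (simp_all add: power_mult_distrib flip: power_add)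
    have "(of_real \<gamma> + of_real \<beta> * \<kappa> ^ 4) * (p * (\<i> * m) ^ 2 * e) + \<kappa>\<^sup>2 * (d * (\<i> * m) ^ 2 * e) +
         of_real \<beta> * \<kappa> ^ 4 * (p * (\<i> * m) ^ 4 * e) - \<kappa>\<^sup>2 * (q * (\<i> * m) ^ 2 * e) +
         of_real \<gamma> * (p * (\<i> * m) ^ 0 * e) =
         e * (\<kappa>\<^sup>2 * m ^ 2 * (q - d) - (m ^ 2 - 1) * (of_real \<gamma> - of_real \<beta> * \<kappa> ^ 4 * m ^ 2) * p)"
      unfolding i4 by (simp add: algebra_simps)
    thus ?thesis using that by simp
  qed
  show ?thesis
    unfolding trig_def sum_distrib_left sum.distrib[symmetric] sum_subtractf[symmetric]
  proof (rule sum.neutral, rule ballI)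
    fix l assume "l \<in> {..n}"
    hence "l \<le> n" by simp
    note eq = stokes_mode_equation[of \<gamma> \<beta> \<kappa> l n, OF nonres this, folded b_def]
    show "(of_real \<gamma> + of_real \<beta> * \<kappa> ^ 4) * (coeff (stokes b n) l * (\<i> * of_int (freq n l)) ^ 2 * cis (of_int (freq n l) * z)) +
       \<kappa>\<^sup>2 * (coeff (stokes_drift b n) l * (\<i> * of_int (freq n l)) ^ 2 * cis (of_int (freq n l) * z)) +
       of_real \<beta> * \<kappa> ^ 4 * (coeff (stokes b n) l * (\<i> * of_int (freq n l)) ^ 4 * cis (of_int (freq n l) * z)) -
       \<kappa>\<^sup>2 * (coeff (stokes_sq b n) l * (\<i> * of_int (freq n l)) ^ 2 * cis (of_int (freq n l) * z)) +
       of_real \<gamma> * (coeff (stokes b n) l * (\<i> * of_int (freq n l)) ^ 0 * cis (of_int (freq n l) * z)) = 0"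
      by (rule mode[OF eq])
  qed
qed

section \<open>The coefficients up to fourth order\<close>

text \<open>As an explicit list, the low-order entries can be computed by rewriting.\<close>

lemma stokes_eq_Poly:
  assumes "n \<ge> 2"
  shows "stokes b n = Poly (map (\<lambda>l. b (freq n l) * coeff (stokes_sq b n - stokes_drift b n) l) [0..<Suc n])"
proof (rule poly_eqI)
  fix l
  show "coeff (stokes b n) l = coeff (Poly (map (\<lambda>l. b (freq n l) * coeff (stokes_sq b n - stokes_drift b n) l) [0..<Suc n])) l"
  proof (cases "l \<le> n")
    case True
    thus ?thesis using assms
      by (simp add: coeff_stokes nth_default_def del: upt_Suc)
  next
    case False
    hence "coeff (stokes b n) l = 0" using degree_stokes[of b n] by (intro coeff_eq_0) simp
    thus ?thesis using False by (simp add: nth_default_def del: upt_Suc)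
  qed
qed

context
  fixes b :: "int \<Rightarrow> complex" and \<alpha> \<tau> \<sigma> :: real
  assumes even: "\<And>m. b (- m) = b m" and b0: "b 0 = 0" and b1: "b 1 = 0"
    and b2: "b 2 = of_real (2 * \<alpha>)" and b3: "b 3 = of_real \<tau>" and b4: "b 4 = of_real \<sigma>"
begin

text \<open>The square of cos z has coefficient 1/4 at frequencies 2 and -2. With \<open>b 2\<close>
  written as 2 \<alpha> this yields \<alpha> cos 2z, so \<alpha> is the amplitude A_2
  itself.\<close>

lemma stokes_2: "stokes b 2 = [:of_real (\<alpha> / 2), 0, of_real (\<alpha> / 2):]"
proof -
  have sq: "stokes_sq b 2 = [:1/4, 1/2, 1/4:]"
    by (simp add: stokes_sq_def numeral_2_eq_2)
  have drift: "stokes_drift b 2 = 0"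
    by (simp add: stokes_drift_def stokes_speed_def numeral_2_eq_2)
  have "[0..<Suc 2] = [0, 1, 2]" by (simp add: upt_rec)
  thus ?thesis
    using even[of 2] by (simp add: stokes_eq_Poly sq drift freq_def b0 b2 coeff_pCons)
qed

lemma stokes_sq_3: "stokes_sq b 3 = smult (of_real (\<alpha> / 2)) [:1, 1, 1, 1:]"
proof -
  have "{1..<3} = {1, 2::nat}" by auto
  thus ?thesis by (simp add: stokes_sq_def stokes_2)
qed

lemma stokes_speed_2: "stokes_speed b 2 = of_real \<alpha>"
  using stokes_sq_3 by (simp add: stokes_speed_def numeral_3_eq_3 coeff_pCons)

lemma stokes_3: "stokes b 3 = [:of_real (\<alpha> * \<tau> / 2), 0, 0, of_real (\<alpha> * \<tau> / 2):]"
proof -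
  have "{1..<3} = {1, 2::nat}" by auto
  hence drift: "stokes_drift b 3 = smult (of_real \<alpha>) [:0, 1/2, 1/2:]"
    by (simp add: stokes_drift_def stokes_speed_2 stokes_speed_odd monom_Suc monom_0)
  have "[0..<Suc 3] = [0, 1, 2, 3]" by (simp add: upt_rec)
  thus ?thesis
    using even[of 3] even[of 1] by (simp add: stokes_eq_Poly stokes_sq_3 drift freq_def b1 b3 coeff_pCons)
qed

text \<open>At frequency 2 the square contributes the product of orders 1 and 3, and the drift
  subtracts \<alpha> times order 2. Frequency 4 comes from the square alone, and the mean of the
  square is removed by \<open>b 0 = 0\<close>.\<close>

lemma stokes_4:
  defines "A42 \<equiv> 2 * \<alpha> * (\<alpha> * \<tau>) - 2 * \<alpha> ^ 3" and "A44 \<equiv> \<sigma> / 2 * (\<alpha> ^ 2 + 2 * (\<alpha> * \<tau>))"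
  shows "stokes b 4 = [:of_real (A44 / 2), of_real (A42 / 2), 0, of_real (A42 / 2), of_real (A44 / 2):]"
proof -
  have "{1..<4} = {1, 2, 3::nat}" by auto
  hence sq: "stokes_sq b 4 = [:of_real (\<alpha> * \<tau> / 2 + \<alpha> ^ 2 / 4), of_real (\<alpha> * \<tau> / 2), of_real (\<alpha> ^ 2 / 2),
      of_real (\<alpha> * \<tau> / 2), of_real (\<alpha> * \<tau> / 2 + \<alpha> ^ 2 / 4):]"
    by (simp add: stokes_sq_def stokes_2 stokes_3 power2_eq_square field_simps)
  have "{1..<4} = {1, 2, 3::nat}" by auto
  hence drift: "stokes_drift b 4 = smult (of_real \<alpha>) [:0, of_real (\<alpha> / 2), 0, of_real (\<alpha> / 2):]"
    by (simp add: stokes_drift_def stokes_speed_2 stokes_speed_odd stokes_2 monom_Suc monom_0)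
  have "[0..<Suc 4] = [0, 1, 2, 3, 4]" by (simp add: upt_rec)
  thus ?thesis
    using even[of 4] even[of 2]
    by (simp add: stokes_eq_Poly sq drift freq_def b0 b2 b4 coeff_pCons A42_def A44_def
        power2_eq_square power3_eq_cube field_simps)
qed

text \<open>Frequency 1 of the fifth-order square arises as 2 - 1 from orders 4 and 1, and as 3 - 2
  from orders 3 and 2.\<close>

lemma stokes_speed_4: "stokes_speed b 4 = of_real (3 * \<alpha> * (\<alpha> * \<tau>) - 2 * \<alpha> ^ 3)"
proof -
  have "{1..<5} = {1, 2, 3, 4::nat}" by auto
  hence "coeff (stokes_sq b 5) 3 = of_real (3 * \<alpha> * (\<alpha> * \<tau>) - 2 * \<alpha> ^ 3) / 2"
    by (simp add: stokes_sq_def stokes_2 stokes_3 stokes_4 coeff_pCons power2_eq_square power3_eq_cube field_simps)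
  thus ?thesis by (simp add: stokes_speed_def mult.commute[of 2])
qed

lemma Re_trig_stokes:
  "Re (trig 0 (stokes b 1) 1 z) = cos z"
  "Re (trig 0 (stokes b 2) 2 z) = \<alpha> * cos (2 * z)"
  "Re (trig 0 (stokes b 3) 3 z) = \<alpha> * \<tau> * cos (3 * z)"
  "Re (trig 0 (stokes b 4) 4 z) =
     (2 * \<alpha> * (\<alpha> * \<tau>) - 2 * \<alpha> ^ 3) * cos (2 * z) + \<sigma> / 2 * (\<alpha> ^ 2 + 2 * (\<alpha> * \<tau>)) * cos (4 * z)"
proof -
  show "Re (trig 0 (stokes b 1) 1 z) = cos z"
    by (simp add: trig_def freq_def)
  have "{..2} = {0, 1, 2::nat}" "{..3} = {0, 1, 2, 3::nat}" "{..4} = {0, 1, 2, 3, 4::nat}" by auto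
  thus "Re (trig 0 (stokes b 2) 2 z) = \<alpha> * cos (2 * z)"
    "Re (trig 0 (stokes b 3) 3 z) = \<alpha> * \<tau> * cos (3 * z)"
    "Re (trig 0 (stokes b 4) 4 z) =
       (2 * \<alpha> * (\<alpha> * \<tau>) - 2 * \<alpha> ^ 3) * cos (2 * z) + \<sigma> / 2 * (\<alpha> ^ 2 + 2 * (\<alpha> * \<tau>)) * cos (4 * z)"
    unfolding trig_def stokes_2 stokes_3 stokes_4
    by (simp_all add: freq_def coeff_pCons field_simps)
qed

end

section \<open>Uniform nonresonance near admissible wave numbers\<close>

lemma admissible_nonresonant:
  assumes "admissible_k \<gamma> \<beta> k" "\<gamma> > 0" "\<beta> \<noteq> 0" "n \<ge> 2"
  shows "\<gamma> \<noteq> \<beta> * k ^ 4 * real n ^ 2"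
proof
  assume eq: "\<gamma> = \<beta> * k ^ 4 * real n ^ 2"
  have k: "k > 0" using assms(1) by (simp add: admissible_k_def)
  have "\<beta> > 0"
  proof (rule ccontr)
    assume "\<not> \<beta> > 0"
    hence "\<beta> * (k ^ 4 * real n ^ 2) \<le> 0" by (intro mult_nonpos_nonneg) auto
    thus False using eq assms(2) by simp
  qed
  have "\<gamma> / (\<beta> * real n ^ 2) = k ^ 4" using eq \<open>\<beta> > 0\<close> assms(4) by simp
  moreover have "(k ^ 4) powr (1 / 4) = k"
    using k powr_powr[of k 4 "1 / 4"] by simp
  ultimately have "(\<gamma> / (\<beta> * real n ^ 2)) powr (1 / 4) = k" by simp
  thus False using assms(1,4) \<open>\<beta> > 0\<close> by (auto simp: admissible_k_def)
qed

text \<open>Divided by n^2, the divisor tends to -\<beta> k^4, which is nonzero. Hence only finitely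
  many n are left to plain nonresonance.\<close>

lemma admissible_gap:
  assumes "admissible_k \<gamma> \<beta> k" "\<gamma> > 0" "\<beta> \<noteq> 0"
  obtains \<delta> where "\<delta> > 0" "\<And>n::nat. n \<ge> 2 \<Longrightarrow> \<delta> \<le> \<bar>\<gamma> / real n ^ 2 - \<beta> * k ^ 4\<bar>"
proof -
  have k: "k > 0" using assms(1) by (simp add: admissible_k_def)
  define x where "x n = \<bar>\<gamma> / real n ^ 2 - \<beta> * k ^ 4\<bar>" for n :: nat
  define L where "L = \<bar>\<beta>\<bar> * k ^ 4"
  have L: "L > 0" using k assms(3) by (simp add: L_def)
  have "(\<lambda>n. \<gamma> / real n ^ 2) \<longlonglongrightarrow> 0"
    by (rule tendsto_divide_0[OF tendsto_const]) (intro filterlim_at_top_imp_at_infinity filterlim_pow_at_top filterlim_real_sequentially, simp)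
  hence "x \<longlonglongrightarrow> \<bar>0 - \<beta> * k ^ 4\<bar>" unfolding x_def by (intro tendsto_intros)
  hence "x \<longlonglongrightarrow> L" by (simp add: L_def abs_mult)
  hence "eventually (\<lambda>n. L / 2 < x n) sequentially"
    using L by (intro order_tendstoD) auto
  then obtain N where N: "\<And>n. n \<ge> N \<Longrightarrow> L / 2 < x n"
    by (auto simp: eventually_sequentially)
  define \<delta> where "\<delta> = Min (insert (L / 2) (x ` {2..N}))"
  have "x n > 0" if "n \<ge> 2" for n
    using admissible_nonresonant[OF assms that] that by (simp add: x_def field_simps)
  hence "\<delta> > 0" using L by (auto simp: \<delta>_def)
  moreover have "\<delta> \<le> x n" if "n \<ge> 2" for n
  proof (cases "n \<le> N")
    case True
    thus ?thesis unfolding \<delta>_def using that by (intro Min_le) auto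
  next
    case False
    have "\<delta> \<le> L / 2" unfolding \<delta>_def by (intro Min_le) auto
    thus ?thesis using N[of n] False by simp
  qed
  ultimately show ?thesis using that unfolding x_def by blast
qed

text \<open>The disc is complex because Cauchy's inequality in the wave number needs bounds there.
  One constant \<open>B\<close> bounds the response at all frequencies and also c_0, which is order
  0 of the speed series.\<close>

definition good_box :: "real \<Rightarrow> real \<Rightarrow> real \<Rightarrow> real \<Rightarrow> real \<Rightarrow> bool" where
  "good_box \<gamma> \<beta> k1 \<epsilon> B \<longleftrightarrow> \<epsilon> > 0 \<and> B > 0 \<and>
     (\<forall>\<kappa>\<in>ball (complex_of_real k1) \<epsilon>. \<kappa> \<noteq> 0 \<and>
        norm (of_real \<gamma> / \<kappa>\<^sup>2 + of_real \<beta> * \<kappa>\<^sup>2) \<le> B \<and>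
        (\<forall>m::int. \<bar>m\<bar> \<ge> 2 \<longrightarrow> of_real \<gamma> - of_real \<beta> * \<kappa> ^ 4 * of_int m ^ 2 \<noteq> (0::complex)) \<and>
        (\<forall>m. norm (response \<gamma> \<beta> \<kappa> m) \<le> B))"

text \<open>In the divisor divided by m^2 only \<beta> \<kappa>^4 moves with \<kappa>, and it does
  not depend on m. A single perturbation by less than \<delta> / 2 therefore preserves the gap at
  all frequencies at once.\<close>

lemma admissible_good_box:
  assumes adm: "admissible_k \<gamma> \<beta> k" and "\<gamma> > 0" "\<beta> \<noteq> 0"
  shows "\<exists>\<epsilon> B. good_box \<gamma> \<beta> k \<epsilon> B"
proof -
  have k: "k > 0" using adm by (simp add: admissible_k_def)
  obtain \<delta> where \<delta>: "\<delta> > 0" "\<And>n::nat. n \<ge> 2 \<Longrightarrow> \<delta> \<le> \<bar>\<gamma> / real n ^ 2 - \<beta> * k ^ 4\<bar>"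
    using admissible_gap[OF assms] by blast
  have "isCont (\<lambda>\<kappa>::complex. of_real \<beta> * \<kappa> ^ 4) (of_real k)" by (intro continuous_intros)
  from LIM_D[OF this[unfolded isCont_def] half_gt_zero[OF \<delta>(1)]]
  obtain d where d0: "d > 0" and d1: "\<forall>\<kappa>. \<kappa> \<noteq> of_real k \<and> norm (\<kappa> - of_real k) < d \<longrightarrow>
      norm (of_real \<beta> * \<kappa> ^ 4 - of_real \<beta> * of_real k ^ 4 :: complex) < \<delta> / 2"
    by (elim exE conjE)
  have d: "norm (of_real \<beta> * \<kappa> ^ 4 - of_real \<beta> * of_real k ^ 4 :: complex) < \<delta> / 2"
    if "norm (\<kappa> - of_real k) < d" for \<kappa>
    using d1 that \<delta>(1) by (cases "\<kappa> = of_real k") simp_all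
  \<comment> \<open>The bound k / 2 keeps |\<kappa>| between k / 2 and 2 k.\<close>
  define \<epsilon> where "\<epsilon> = min d (k / 2)"
  \<comment> \<open>First entry: 4 k^2 over the remaining gap \<delta> / 2, for the response. Second
    entry: the bound for c_0 when k / 2 \<le> |\<kappa>| \<le> 2 k.\<close>
  define B where "B = max (8 * k\<^sup>2 / \<delta>) (\<gamma> / (k\<^sup>2 / 4) + \<bar>\<beta>\<bar> * (4 * k\<^sup>2))"
  have \<epsilon>: "\<epsilon> > 0" using d0 k by (simp add: \<epsilon>_def)
  have B: "B > 0" using k \<delta> by (auto simp: B_def less_max_iff_disj)
  have "\<kappa> \<noteq> 0 \<and> norm (of_real \<gamma> / \<kappa>\<^sup>2 + of_real \<beta> * \<kappa>\<^sup>2) \<le> B \<and>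
        (\<forall>m::int. \<bar>m\<bar> \<ge> 2 \<longrightarrow> of_real \<gamma> - of_real \<beta> * \<kappa> ^ 4 * of_int m ^ 2 \<noteq> (0::complex)) \<and>
        (\<forall>m. norm (response \<gamma> \<beta> \<kappa> m) \<le> B)" if "\<kappa> \<in> ball (of_real k) \<epsilon>" for \<kappa>
  proof -
    have dist: "norm (\<kappa> - of_real k) < \<epsilon>" using that by (simp add: dist_norm norm_minus_commute)
    have "norm (\<kappa> - of_real k) \<le> k / 2" using dist by (simp add: \<epsilon>_def)
    moreover have "norm \<kappa> \<le> norm (\<kappa> - of_real k) + norm (of_real k :: complex)"
      using norm_triangle_ineq[of "\<kappa> - of_real k" "of_real k"] by simp
    moreover have "norm (of_real k :: complex) \<le> norm (\<kappa> - of_real k) + norm \<kappa>"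
      using norm_triangle_ineq[of "of_real k - \<kappa>" \<kappa>] by (simp add: norm_minus_commute)
    ultimately have upper: "norm \<kappa> \<le> 2 * k" and lower: "k / 2 \<le> norm \<kappa>"
      using k by simp_all
    have up2: "norm \<kappa> ^ 2 \<le> 4 * k\<^sup>2"
      using power_mono[OF upper, of 2] by (simp add: power2_eq_square)
    have low2: "k\<^sup>2 / 4 \<le> norm \<kappa> ^ 2"
      using power_mono[OF lower, of 2] k by (simp add: power2_eq_square)
    have ne: "\<kappa> \<noteq> 0" using lower k by auto
    have gap: "\<delta> / 2 \<le> norm (of_real \<gamma> / of_int m ^ 2 - of_real \<beta> * \<kappa> ^ 4)"
      if "\<bar>m\<bar> \<ge> 2" for m :: int
    proof -
      define n where "n = nat \<bar>m\<bar>"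
      have n: "n \<ge> 2" "real n ^ 2 = of_int m ^ 2" using that by (auto simp: n_def)
      have "norm (of_real \<beta> * \<kappa> ^ 4 - of_real \<beta> * of_real k ^ 4) < \<delta> / 2"
        using dist by (intro d) (simp add: \<epsilon>_def)
      moreover have "norm (of_real \<gamma> / of_int m ^ 2 - of_real \<beta> * of_real k ^ 4 :: complex) \<ge> \<delta>"
      proof -
        have "of_real \<gamma> / of_int m ^ 2 - of_real \<beta> * of_real k ^ 4 = complex_of_real (\<gamma> / real n ^ 2 - \<beta> * k ^ 4)"
          unfolding n(2) by simp
        thus ?thesis using \<delta>(2)[OF n(1)] by (simp only: norm_of_real)
      qed
      moreover have "norm (of_real \<gamma> / of_int m ^ 2 - of_real \<beta> * of_real k ^ 4 :: complex) \<le>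
          norm (of_real \<gamma> / of_int m ^ 2 - of_real \<beta> * \<kappa> ^ 4) +
          norm (of_real \<beta> * \<kappa> ^ 4 - of_real \<beta> * of_real k ^ 4)"
        using norm_triangle_ineq[of "of_real \<gamma> / of_int m ^ 2 - of_real \<beta> * \<kappa> ^ 4"
            "of_real \<beta> * \<kappa> ^ 4 - of_real \<beta> * of_real k ^ 4"] by simp
      ultimately show ?thesis by linarith
    qed
    have factor: "of_real \<gamma> - of_real \<beta> * \<kappa> ^ 4 * of_int m ^ 2 =
        (of_real \<gamma> / of_int m ^ 2 - of_real \<beta> * \<kappa> ^ 4) * of_int m ^ 2" if "\<bar>m\<bar> \<ge> 2" for m :: int
    proof -
      have "complex_of_int m \<noteq> 0" using that by auto
      thus ?thesis by (simp add: field_simps)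
    qed
    have nonres: "of_real \<gamma> - of_real \<beta> * \<kappa> ^ 4 * of_int m ^ 2 \<noteq> (0::complex)" if "\<bar>m\<bar> \<ge> 2" for m :: int
    proof -
      have "complex_of_int m \<noteq> 0" using that by auto
      moreover have "of_real \<gamma> / of_int m ^ 2 - of_real \<beta> * \<kappa> ^ 4 \<noteq> 0"
        using gap[OF that] \<delta>(1) by auto
      ultimately show ?thesis unfolding factor[OF that] by simp
    qed
    have resp: "norm (response \<gamma> \<beta> \<kappa> m) \<le> B" for m
    proof (cases "\<bar>m\<bar> \<ge> 2")
      case True
      define q where "q = of_real \<gamma> / of_int m ^ 2 - of_real \<beta> * \<kappa> ^ 4"
      have m0: "complex_of_int m \<noteq> 0" using True by auto
      have "2 ^ 2 \<le> \<bar>m\<bar> ^ 2" by (rule power_mono) (use True in auto)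
      hence m2: "4 \<le> m ^ 2" by simp
      \<comment> \<open>The m^2 of the numerator cancels against the one factored out of the
        divisor, so the bound is uniform in m.\<close>
      have "response \<gamma> \<beta> \<kappa> m = \<kappa>\<^sup>2 / (of_int (m ^ 2 - 1) * q)"
        unfolding response_def factor[OF True] q_def[symmetric] using m0 by simp
      hence "norm (response \<gamma> \<beta> \<kappa> m) = norm \<kappa> ^ 2 / (of_int (m ^ 2 - 1) * norm q)"
        using m2 by (simp only: norm_divide norm_mult norm_power norm_of_int)
      also have "\<dots> \<le> 4 * k\<^sup>2 / (1 * (\<delta> / 2))"
      proof (rule frac_le)
        have "1 * (\<delta> / 2) \<le> of_int (m ^ 2 - 1) * norm q"
        proof (rule mult_mono)
          have "1 \<le> m ^ 2 - 1" using m2 by simp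
          thus "1 \<le> real_of_int (m ^ 2 - 1)" by linarith
          show "\<delta> / 2 \<le> norm q" using gap[OF True] by (simp add: q_def)
          show "0 \<le> real_of_int (m ^ 2 - 1)" using m2 by linarith
        qed (use \<delta> in auto)
        thus "1 * (\<delta> / 2) \<le> of_int (m ^ 2 - 1) * norm q" .
      qed (use up2 \<delta> in auto)
      also have "\<dots> \<le> B" by (simp add: B_def)
      finally show ?thesis .
    next
      case False
      hence "m = 0 \<or> m = 1 \<or> m = - 1" by linarith
      thus ?thesis using B response_minus[of \<gamma> \<beta> \<kappa> 1] by (elim disjE) simp_all
    qed
    have "norm (of_real \<gamma> / \<kappa>\<^sup>2 + of_real \<beta> * \<kappa>\<^sup>2) \<le> \<gamma> / norm \<kappa> ^ 2 + \<bar>\<beta>\<bar> * norm \<kappa> ^ 2"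
      using norm_triangle_ineq[of "of_real \<gamma> / \<kappa>\<^sup>2" "of_real \<beta> * \<kappa>\<^sup>2"] assms(2)
      by (simp add: norm_divide norm_mult norm_power)
    also have "\<dots> \<le> \<gamma> / (k\<^sup>2 / 4) + \<bar>\<beta>\<bar> * (4 * k\<^sup>2)"
      using up2 low2 k assms(2) by (intro add_mono divide_left_mono mult_left_mono mult_pos_pos) (auto intro: less_le_trans[OF _ low2])
    also have "\<dots> \<le> B" by (simp add: B_def)
    finally show ?thesis using ne nonres resp by blast
  qed
  thus ?thesis using \<epsilon> B unfolding good_box_def by blast
qed

text \<open>No disc, bound or radius enters the formula, so statements proved over different boxes
  concern one and the same function.\<close>

definition stokes_wave :: "real \<Rightarrow> real \<Rightarrow> real \<Rightarrow> real \<Rightarrow> real \<Rightarrow> real" where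
  "stokes_wave \<gamma> \<beta> a k z = Re (trig_series 0 (stokes (response \<gamma> \<beta> (of_real k))) a z)"

definition wave_speed :: "real \<Rightarrow> real \<Rightarrow> real \<Rightarrow> real \<Rightarrow> real" where
  "wave_speed \<gamma> \<beta> a k = c0_coef \<gamma> \<beta> k + Re (\<Sum>n. stokes_speed (response \<gamma> \<beta> (of_real k)) n * of_real a ^ n)"

text \<open>The two series agree term by term, since odd speed coefficients vanish; convergence
  plays no part.\<close>

lemma wave_speed_even: "wave_speed \<gamma> \<beta> (- a) k = wave_speed \<gamma> \<beta> a k"
proof -
  have "stokes_speed b n * complex_of_real (- a) ^ n = stokes_speed b n * of_real a ^ n" for b n
    by (cases "even n") (simp_all add: stokes_speed_odd)
  thus ?thesis unfolding wave_speed_def by (simp only:)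
qed

lemma good_boxD:
  assumes "good_box \<gamma> \<beta> k1 \<epsilon> B"
  shows "\<epsilon> > 0" "B > 0"
    and "\<kappa> \<in> ball (of_real k1) \<epsilon> \<Longrightarrow> \<kappa> \<noteq> 0"
    and "\<kappa> \<in> ball (of_real k1) \<epsilon> \<Longrightarrow> norm (of_real \<gamma> / \<kappa>\<^sup>2 + of_real \<beta> * \<kappa>\<^sup>2) \<le> B"
    and "\<kappa> \<in> ball (of_real k1) \<epsilon> \<Longrightarrow> \<bar>m\<bar> \<ge> 2 \<Longrightarrow> of_real \<gamma> - of_real \<beta> * \<kappa> ^ 4 * of_int m ^ 2 \<noteq> (0::complex)"
    and "\<kappa> \<in> ball (of_real k1) \<epsilon> \<Longrightarrow> norm (response \<gamma> \<beta> \<kappa> m) \<le> B"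
  using assms unfolding good_box_def by blast+

lemma good_box_bounds:
  assumes box: "good_box \<gamma> \<beta> k1 \<epsilon> B" and \<kappa>: "\<kappa> \<in> ball (of_real k1) \<epsilon>"
  defines "b \<equiv> response \<gamma> \<beta> \<kappa>"
  shows "l1_norm (stokes b n) \<le> 1 / (10 * B) * (20 * B) ^ n"
    and "l1_norm (stokes_sq b n) \<le> 1 / (100 * B\<^sup>2) * (20 * B) ^ n"
    and "norm (stokes_speed b n) \<le> 2 / (5 * B) * (20 * B) ^ n"
proof -
  \<comment> \<open>The largest weight that the majorant condition 20 B \<rho> \<le> 1
    allows.\<close>
  define \<rho> where "\<rho> = 1 / (20 * B)"
  have B: "B > 0" using good_boxD[OF box] by blast
  have \<rho>: "\<rho> > 0" "20 * B * \<rho> \<le> 1" using B by (simp_all add: \<rho>_def)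
  have b: "norm (b m) \<le> B" for m unfolding b_def by (rule good_boxD(6)[OF box \<kappa>])
  have eqs: "2 * \<rho> = 1 / (10 * B)" "4 * \<rho>\<^sup>2 = 1 / (100 * B\<^sup>2)" "8 * \<rho> = 2 / (5 * B)" "1 / \<rho> = 20 * B"
    using B by (simp_all add: \<rho>_def power2_eq_square)
  show "l1_norm (stokes b n) \<le> 1 / (10 * B) * (20 * B) ^ n"
    "l1_norm (stokes_sq b n) \<le> 1 / (100 * B\<^sup>2) * (20 * B) ^ n"
    "norm (stokes_speed b n) \<le> 2 / (5 * B) * (20 * B) ^ n"
    using stokes_bounds[of b B \<rho> n, OF b \<rho>] unfolding eqs by auto
qed

section \<open>The travelling wave\<close>

lemma good_box_convergent:
  assumes box: "good_box \<gamma> \<beta> k1 \<epsilon> B" and \<kappa>: "\<kappa> \<in> ball (of_real k1) \<epsilon>" and a: "\<bar>a\<bar> * (60 * B) < 1"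
  shows "convergent_expansion (stokes (response \<gamma> \<beta> \<kappa>)) (1 / (10 * B)) (20 * B) a"
    and "convergent_expansion (stokes_sq (response \<gamma> \<beta> \<kappa>)) (1 / (100 * B\<^sup>2)) (20 * B) a"
  using good_box_bounds[OF box \<kappa>] good_boxD(2)[OF box] a
  by (auto simp: convergent_expansion_def degree_stokes degree_stokes_sq)

lemma of_real_in_ball: "\<bar>k - k1\<bar> < \<epsilon> \<Longrightarrow> complex_of_real k \<in> ball (of_real k1) \<epsilon>"
  by (simp add: dist_real_def abs_minus_commute)

text \<open>Evaluation in \<open>z\<close> undoes the re-encoding, so what remains is a coefficient
  of the Cauchy product of the speed series with the \<open>j\<close>-th derivative of the
  wave.\<close>

lemma trig_stokes_drift:
  "trig j (stokes_drift b n) n z = (\<Sum>i\<le>n. stokes_speed b i * trig j (stokes b (n - i)) (n - i) z)"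
  unfolding stokes_drift_eq trig_sum trig_smult
proof (rule sum.cong[OF refl])
  fix i assume i: "i \<in> {..n}"
  show "stokes_speed b i * trig j (monom 1 (i div 2) * stokes b (n - i)) n z =
        stokes_speed b i * trig j (stokes b (n - i)) (n - i) z"
  proof (cases "even i")
    case True
    then obtain t where t: "i = 2 * t" by (elim evenE)
    have "trig j (monom 1 t * stokes b (n - 2 * t)) n z = trig j (stokes b (n - 2 * t)) (n - 2 * t) z"
      using i t by (intro trig_monom_mult degree_stokes) auto
    thus ?thesis using t by simp
  qed (simp add: stokes_speed_odd)
qed

lemma trig_stokes_sq:
  "trig 0 (stokes_sq b n) n z = (\<Sum>i\<le>n. trig 0 (stokes b i) i z * trig 0 (stokes b (n - i)) (n - i) z)"
  unfolding stokes_sq_eq trig_sum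
proof (rule sum.cong[OF refl])
  fix i assume i: "i \<in> {..n}"
  show "trig 0 (stokes b i * stokes b (n - i)) n z = trig 0 (stokes b i) i z * trig 0 (stokes b (n - i)) (n - i) z"
    using trig_mult[OF degree_stokes[of b i] degree_stokes[of b "n - i"], of z] i by simp
qed

lemma sum_mult_powers:
  fixes x :: "'a::comm_semiring_1"
  shows "(\<Sum>i\<le>n. (f i * x ^ i) * (g i * x ^ (n - i))) = (\<Sum>i\<le>n. f i * g i) * x ^ n"
  unfolding sum_distrib_right
proof (rule sum.cong[OF refl])
  fix i assume "i \<in> {..n}"
  hence "x ^ n = x ^ i * x ^ (n - i)" by (simp flip: power_add)
  thus "(f i * x ^ i) * (g i * x ^ (n - i)) = f i * g i * x ^ n" by (simp add: mult_ac)
qed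

context
  fixes \<gamma> \<beta> k1 \<epsilon> B a k :: real
  assumes box: "good_box \<gamma> \<beta> k1 \<epsilon> B" and k: "\<bar>k - k1\<bar> < \<epsilon>" and a: "\<bar>a\<bar> * (60 * B) < 1"
begin

private abbreviation "b \<equiv> response \<gamma> \<beta> (of_real k)"

interpretation P: convergent_expansion "stokes b" "1 / (10 * B)" "20 * B" a
  by (rule good_box_convergent[OF box of_real_in_ball[OF k] a])

interpretation Q: convergent_expansion "stokes_sq b" "1 / (100 * B\<^sup>2)" "20 * B" a
  by (rule good_box_convergent[OF box of_real_in_ball[OF k] a])

lemma stokes_wave_eq: "stokes_wave \<gamma> \<beta> a k = (\<lambda>z. Re (trig_series 0 (stokes b) a z))"
  by (simp add: fun_eq_iff stokes_wave_def)

lemma dz_stokes_wave: "dz j (stokes_wave \<gamma> \<beta> a k) = (\<lambda>z. Re (trig_series j (stokes b) a z))"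
  unfolding stokes_wave_eq by (rule P.dz_trig_series)

lemma smooth_stokes_wave: "smooth_fun (stokes_wave \<gamma> \<beta> a k)"
  unfolding stokes_wave_eq by (rule P.smooth_trig_series)

lemma stokes_wave_periodic: "stokes_wave \<gamma> \<beta> a k (z + 2 * pi) = stokes_wave \<gamma> \<beta> a k z"
  by (simp add: stokes_wave_def trig_series_def trig_periodic)

lemma palindromic_stokes_response: "palindromic n (stokes b n)"
  by (rule palindromic_stokes) simp

lemma stokes_wave_even: "stokes_wave \<gamma> \<beta> a k (- z) = stokes_wave \<gamma> \<beta> a k z"
  by (simp add: stokes_wave_def trig_series_def trig_even palindromic_stokes_response)

lemma trig_series_stokes_sq: "trig_series 0 (stokes_sq b) a z = (trig_series 0 (stokes b) a z)\<^sup>2"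
proof -
  have "(\<lambda>n. \<Sum>i\<le>n. (trig 0 (stokes b i) i z * of_real a ^ i) *
            (trig 0 (stokes b (n - i)) (n - i) z * of_real a ^ (n - i))) sums
        (trig_series 0 (stokes b) a z * trig_series 0 (stokes b) a z)"
    unfolding trig_series_def
    by (intro Cauchy_product_sums P.summable_norm_trig)
  also have "(\<lambda>n. \<Sum>i\<le>n. (trig 0 (stokes b i) i z * of_real a ^ i) *
            (trig 0 (stokes b (n - i)) (n - i) z * of_real a ^ (n - i))) =
        (\<lambda>n. trig 0 (stokes_sq b n) n z * of_real a ^ n)"
    by (simp only: trig_stokes_sq sum_mult_powers)
  finally show ?thesis
    using sums_unique2[OF Q.trig_series_sums[of 0 z]] by (simp add: power2_eq_square)
qed

text \<open>Real part and square commute here because the series itself is real: the response is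
  real at real \<open>k\<close>, and the entries are even.\<close>

lemma stokes_wave_squared: "(stokes_wave \<gamma> \<beta> a k z)\<^sup>2 = Re (trig_series 0 (stokes_sq b) a z)"
proof -
  have "trig_series 0 (stokes b) a z \<in> \<real>"
    by (intro P.trig_series_real palindromic_stokes_response stokes_real(1) response_real)
  hence "Im (trig_series 0 (stokes b) a z) = 0" by (simp add: complex_is_Real_iff)
  thus ?thesis unfolding trig_series_stokes_sq by (simp add: stokes_wave_def power2_eq_square)
qed

lemma speed_term_le: "norm (stokes_speed b n * of_real a ^ n) \<le> 2 / (5 * B) * (\<bar>a\<bar> * (20 * B)) ^ n"
  using mult_right_mono[OF good_box_bounds(3)[OF box of_real_in_ball[OF k], of n], of "\<bar>a\<bar> ^ n"]
  by (simp add: norm_mult norm_power power_mult_distrib mult_ac)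

lemma summable_norm_speed: "summable (\<lambda>n. norm (stokes_speed b n * of_real a ^ n))"
proof (rule summable_comparison_test')
  have "\<bar>a\<bar> * (20 * B) \<le> \<bar>a\<bar> * (60 * B)" using good_boxD(2)[OF box] by (intro mult_left_mono) auto
  hence "\<bar>a\<bar> * (20 * B) < 1" using a by linarith
  thus "summable (\<lambda>n. 2 / (5 * B) * (\<bar>a\<bar> * (20 * B)) ^ n)"
    using good_boxD(2)[OF box] by (intro summable_mult summable_geometric) auto
  show "norm (norm (stokes_speed b n * of_real a ^ n)) \<le> 2 / (5 * B) * (\<bar>a\<bar> * (20 * B)) ^ n" if "n \<ge> 0" for n
    using speed_term_le by simp
qed

lemma sum_speed_real: "(\<Sum>n. stokes_speed b n * of_real a ^ n) = of_real (Re (\<Sum>n. stokes_speed b n * of_real a ^ n))"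
proof -
  have "stokes_speed b n \<in> \<real>" for n by (rule stokes_real(2)) (rule response_real)
  hence Im: "Im (stokes_speed b n * of_real a ^ n) = 0" for n
    by (simp add: complex_is_Real_iff flip: of_real_power)
  have "(\<lambda>n. Im (stokes_speed b n * of_real a ^ n)) sums Im (\<Sum>n. stokes_speed b n * of_real a ^ n)"
    by (intro sums_Im summable_sums summable_norm_cancel[OF summable_norm_speed])
  hence "Im (\<Sum>n. stokes_speed b n * of_real a ^ n) = 0" unfolding Im using sums_unique2 sums_zero by metis
  thus ?thesis by (simp add: complex_eq_iff)
qed

text \<open>The identities of each order are summed against powers of \<open>a\<close>. The square
  is an expansion of the same kind as the wave, so its second derivative is taken termwise without a
  product rule; the speed correction times w'' is recovered by a Cauchy product.\<close>

lemma stokes_wave_equation: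
  "wave_speed \<gamma> \<beta> a k * k^2 * dz 2 (stokes_wave \<gamma> \<beta> a k) z + \<beta> * k^4 * dz 4 (stokes_wave \<gamma> \<beta> a k) z
     - k^2 * dz 2 (\<lambda>y. (stokes_wave \<gamma> \<beta> a k y)^2) z + \<gamma> * stokes_wave \<gamma> \<beta> a k z = 0"
proof -
  let ?\<kappa> = "complex_of_real k"
  define cs where "cs = Re (\<Sum>n. stokes_speed b n * of_real a ^ n)"
  have nonres: "of_real \<gamma> - of_real \<beta> * ?\<kappa> ^ 4 * of_int m ^ 2 \<noteq> (0::complex)" if "\<bar>m\<bar> \<ge> 2" for m :: int
    using good_boxD(5)[OF box of_real_in_ball[OF k] that] .
  have k0: "k \<noteq> 0" using good_boxD(3)[OF box of_real_in_ball[OF k]] by simp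
  have "(\<lambda>n. \<Sum>i\<le>n. (stokes_speed b i * of_real a ^ i) *
            (trig 2 (stokes b (n - i)) (n - i) z * of_real a ^ (n - i))) sums
        ((\<Sum>n. stokes_speed b n * of_real a ^ n) * trig_series 2 (stokes b) a z)"
    unfolding trig_series_def
    by (intro Cauchy_product_sums P.summable_norm_trig summable_norm_speed)
  also have "(\<lambda>n. \<Sum>i\<le>n. (stokes_speed b i * of_real a ^ i) *
            (trig 2 (stokes b (n - i)) (n - i) z * of_real a ^ (n - i))) =
        (\<lambda>n. trig 2 (stokes_drift b n) n z * of_real a ^ n)"
    by (simp only: trig_stokes_drift sum_mult_powers)
  finally have drift: "(\<lambda>n. trig 2 (stokes_drift b n) n z * of_real a ^ n) sums (of_real cs * trig_series 2 (stokes b) a z)"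
    unfolding cs_def by (subst (asm) sum_speed_real)
  have S: "(\<lambda>n. (of_real \<gamma> + of_real \<beta> * ?\<kappa> ^ 4) * (trig 2 (stokes b n) n z * of_real a ^ n) +
          ?\<kappa>\<^sup>2 * (trig 2 (stokes_drift b n) n z * of_real a ^ n) +
          of_real \<beta> * ?\<kappa> ^ 4 * (trig 4 (stokes b n) n z * of_real a ^ n) -
          ?\<kappa>\<^sup>2 * (trig 2 (stokes_sq b n) n z * of_real a ^ n) +
          of_real \<gamma> * (trig 0 (stokes b n) n z * of_real a ^ n)) sums
        ((of_real \<gamma> + of_real \<beta> * ?\<kappa> ^ 4) * trig_series 2 (stokes b) a z +
          ?\<kappa>\<^sup>2 * (of_real cs * trig_series 2 (stokes b) a z) +
          of_real \<beta> * ?\<kappa> ^ 4 * trig_series 4 (stokes b) a z -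
          ?\<kappa>\<^sup>2 * trig_series 2 (stokes_sq b) a z + of_real \<gamma> * trig_series 0 (stokes b) a z)" (is "?f sums ?S")
    by (intro sums_add sums_diff sums_mult drift P.trig_series_sums Q.trig_series_sums)
  have f0: "?f = (\<lambda>n. 0)"
  proof
    fix n
    have "?f n = ((of_real \<gamma> + of_real \<beta> * ?\<kappa> ^ 4) * trig 2 (stokes b n) n z + ?\<kappa>\<^sup>2 * trig 2 (stokes_drift b n) n z +
         of_real \<beta> * ?\<kappa> ^ 4 * trig 4 (stokes b n) n z - ?\<kappa>\<^sup>2 * trig 2 (stokes_sq b n) n z +
         of_real \<gamma> * trig 0 (stokes b n) n z) * of_real a ^ n"
      by (simp only: ring_distribs mult.assoc)
    also have "\<dots> = 0" by (subst trig_stokes_equation[OF nonres]) simp_all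
    finally show "?f n = 0" .
  qed
  have "?S = 0" by (rule sums_unique2[OF S[unfolded f0] sums_zero])
  \<comment> \<open>All multipliers, including the sum \<open>cs\<close> of the speed corrections,
    are real, so real parts pass through.\<close>
  moreover have "Re ?S = (\<gamma> + \<beta> * k ^ 4 + k\<^sup>2 * cs) * Re (trig_series 2 (stokes b) a z) +
      \<beta> * k ^ 4 * Re (trig_series 4 (stokes b) a z) - k\<^sup>2 * Re (trig_series 2 (stokes_sq b) a z) +
      \<gamma> * Re (trig_series 0 (stokes b) a z)"
    by (simp add: algebra_simps flip: of_real_power)
  ultimately have "(\<gamma> + \<beta> * k ^ 4 + k\<^sup>2 * cs) * Re (trig_series 2 (stokes b) a z) +
      \<beta> * k ^ 4 * Re (trig_series 4 (stokes b) a z) - k\<^sup>2 * Re (trig_series 2 (stokes_sq b) a z) +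
      \<gamma> * Re (trig_series 0 (stokes b) a z) = 0" by simp
  moreover have "wave_speed \<gamma> \<beta> a k * k\<^sup>2 = \<gamma> + \<beta> * k ^ 4 + k\<^sup>2 * cs"
    using k0 by (simp add: wave_speed_def c0_coef_def cs_def field_simps power2_eq_square power4_eq_xxxx)
  moreover have "dz 2 (\<lambda>y. (stokes_wave \<gamma> \<beta> a k y)^2) z = Re (trig_series 2 (stokes_sq b) a z)"
    unfolding stokes_wave_squared Q.dz_trig_series ..
  ultimately show ?thesis
    unfolding dz_stokes_wave by (simp add: stokes_wave_def)
qed

end

section \<open>Joint analyticity in amplitude and wave number\<close>

lemma holomorphic_response:
  assumes box: "good_box \<gamma> \<beta> k1 \<epsilon> B"
  shows "(\<lambda>\<kappa>. response \<gamma> \<beta> \<kappa> m) holomorphic_on ball (of_real k1) \<epsilon>"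
proof (cases "\<bar>m\<bar> \<ge> 2")
  case True
  have "complex_of_int m ^ 2 - 1 \<noteq> 0"
  proof
    assume "complex_of_int m ^ 2 - 1 = 0"
    hence "of_int (m ^ 2) = (of_int 1 :: complex)" by simp
    hence "m ^ 2 = 1" by (simp only: of_int_eq_iff)
    hence "m = 1 \<or> m = - 1" by (simp only: power2_eq_1_iff)
    thus False using True by (elim disjE) simp_all
  qed
  thus ?thesis unfolding response_def
    using good_boxD(5)[OF box _ True] by (intro holomorphic_intros) auto
next
  case False
  hence "m = 0 \<or> m = 1 \<or> m = - 1" by linarith
  \<comment> \<open>At m = 1 and m = -1 the denominator is 0 for every \<kappa>, so division by zero
    gives the zero function rather than a pole.\<close>
  hence "(\<lambda>\<kappa>. response \<gamma> \<beta> \<kappa> m) = (\<lambda>_. 0)"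
    using response_minus[of \<gamma> \<beta> _ 1] by (elim disjE) simp_all
  thus ?thesis by simp
qed

lemma holomorphic_stokes:
  assumes box: "good_box \<gamma> \<beta> k1 \<epsilon> B"
  shows "(\<lambda>\<kappa>. coeff (stokes (response \<gamma> \<beta> \<kappa>) n) l) holomorphic_on ball (of_real k1) \<epsilon>"
    and "(\<lambda>\<kappa>. stokes_speed (response \<gamma> \<beta> \<kappa>) n) holomorphic_on ball (of_real k1) \<epsilon>"
proof -
  let ?A = "\<lambda>f. f holomorphic_on ball (complex_of_real k1) \<epsilon>"
  have 1: "?A (\<lambda>x. of_real c)" for c by (rule holomorphic_on_const)
  have 2: "?A (\<lambda>x. f x + g x)" if "?A f" "?A g" for f g using that by (rule holomorphic_on_add)
  have 3: "?A (\<lambda>x. f x * g x)" if "?A f" "?A g" for f g using that by (rule holomorphic_on_mult)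
  note 4 = holomorphic_response[OF box]
  show "(\<lambda>\<kappa>. coeff (stokes (response \<gamma> \<beta> \<kappa>) n) l) holomorphic_on ball (of_real k1) \<epsilon>"
    by (rule stokes_coeff_induct(1)[of ?A "response \<gamma> \<beta>" n l, OF 1 2 3 4])
  show "(\<lambda>\<kappa>. stokes_speed (response \<gamma> \<beta> \<kappa>) n) holomorphic_on ball (of_real k1) \<epsilon>"
    by (rule stokes_coeff_induct(2)[of ?A "response \<gamma> \<beta>" n, OF 1 2 3 4])
qed

text \<open>The range of \<open>a\<close> is tied to the box, because \<open>B\<close> blows up as
  \<open>k\<close> approaches a resonance; hence a union of products instead of one product.\<close>

definition wave_domain :: "real \<Rightarrow> real \<Rightarrow> (real \<times> real) set" where
  "wave_domain \<gamma> \<beta> = (\<Union>(k1, \<epsilon>, B)\<in>{(k1, \<epsilon>, B). good_box \<gamma> \<beta> k1 \<epsilon> B}.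
     {a. \<bar>a\<bar> * (60 * B) < 1} \<times> {k. \<bar>k - k1\<bar> < \<epsilon>})"

lemma wave_domainI:
  "good_box \<gamma> \<beta> k1 \<epsilon> B \<Longrightarrow> \<bar>a\<bar> * (60 * B) < 1 \<Longrightarrow> \<bar>k - k1\<bar> < \<epsilon> \<Longrightarrow> (a, k) \<in> wave_domain \<gamma> \<beta>"
  unfolding wave_domain_def by blast

lemma wave_domainE:
  assumes "(a, k) \<in> wave_domain \<gamma> \<beta>"
  obtains k1 \<epsilon> B where "good_box \<gamma> \<beta> k1 \<epsilon> B" "\<bar>k - k1\<bar> < \<epsilon>" "\<bar>a\<bar> * (60 * B) < 1"
  using assms unfolding wave_domain_def by blast

lemma open_wave_domain: "open (wave_domain \<gamma> \<beta>)"
  unfolding wave_domain_def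
proof (intro open_UN ballI)
  fix p :: "real \<times> real \<times> real"
  obtain k1 \<epsilon> B where p: "p = (k1, \<epsilon>, B)" by (cases p)
  have "open ({a::real. \<bar>a\<bar> * (60 * B) < 1} \<times> {k::real. \<bar>k - k1\<bar> < \<epsilon>})"
    by (intro open_Times open_Collect_less continuous_intros)
  thus "open (case p of (k1, \<epsilon>, B) \<Rightarrow> {a. \<bar>a\<bar> * (60 * B) < 1} \<times> {k. \<bar>k - k1\<bar> < \<epsilon>})"
    by (simp add: p)
qed

lemma fam_analytic_stokes_wave: "fam_analytic_on (\<lambda>a k. dz j (stokes_wave \<gamma> \<beta> a k)) (wave_domain \<gamma> \<beta>)"
  unfolding fam_analytic_on_def
proof (rule ballI, rule prod.splits(1)[THEN iffD2], intro allI impI)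
  fix p a0 k0 assume "p \<in> wave_domain \<gamma> \<beta>" "p = (a0, k0)"
  then obtain k1 \<epsilon> B where box: "good_box \<gamma> \<beta> k1 \<epsilon> B" and k0: "\<bar>k0 - k1\<bar> < \<epsilon>" and a0: "\<bar>a0\<bar> * (60 * B) < 1"
    using wave_domainE by metis
  have B: "B > 0" by (rule good_boxD(2)[OF box])
  let ?G = "\<lambda>n z \<kappa>. trig j (stokes (response \<gamma> \<beta> \<kappa>) n) n z"
  show "\<exists>r > 0. \<exists>C :: nat \<Rightarrow> nat \<Rightarrow> real \<Rightarrow> real. \<exists>M :: nat \<Rightarrow> nat \<Rightarrow> real.
       (\<forall>i j z. \<bar>C i j z\<bar> \<le> M i j) \<and>
       (\<forall>a k. (a - a0)^2 + (k - k0)^2 < r^2 \<longrightarrow>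
          (\<lambda>(i, j). M i j * \<bar>a - a0\<bar>^i * \<bar>k - k0\<bar>^j) summable_on UNIV \<and>
          (\<forall>z. ((\<lambda>(i, l). C i l z * (a - a0)^i * (k - k0)^l) has_sum dz j (stokes_wave \<gamma> \<beta> a k) z) UNIV))"
  proof (rule double_series_expansion[where G = ?G and K = "real j ^ j * (1 / (10 * B))" and R = "60 * B"])
    show "?G n z holomorphic_on ball (of_real k1) \<epsilon>" for n z
      unfolding trig_def by (intro holomorphic_intros holomorphic_stokes[OF box])
    show "norm (?G n z \<kappa>) \<le> real j ^ j * (1 / (10 * B)) * (60 * B) ^ n" if "\<kappa> \<in> ball (of_real k1) \<epsilon>" for n z \<kappa>
    proof -
      \<comment> \<open>Only the coefficient bounds of the locale are wanted, so amplitude 0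
        serves.\<close>
      interpret convergent_expansion "stokes (response \<gamma> \<beta> \<kappa>)" "1 / (10 * B)" "20 * B" 0
        by (rule good_box_convergent[OF box that]) simp
      show ?thesis using norm_trig_T[of j n z] by simp
    qed
    show "dz j (stokes_wave \<gamma> \<beta> a k) z = Re (\<Sum>n. ?G n z (of_real k) * of_real a ^ n)"
      if "\<bar>a\<bar> * (60 * B) < 1" "\<bar>k - k1\<bar> < \<epsilon>" for a k z
      unfolding dz_stokes_wave[OF box that(2,1)] trig_series_def ..
  qed (use B a0 k0 in auto)
qed

lemma fam_analytic_wave_speed: "fam_analytic_on (\<lambda>a k z. wave_speed \<gamma> \<beta> a k) (wave_domain \<gamma> \<beta>)"
  unfolding fam_analytic_on_def
proof (rule ballI, rule prod.splits(1)[THEN iffD2], intro allI impI)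
  fix p a0 k0 assume "p \<in> wave_domain \<gamma> \<beta>" "p = (a0, k0)"
  then obtain k1 \<epsilon> B where box: "good_box \<gamma> \<beta> k1 \<epsilon> B" and k0: "\<bar>k0 - k1\<bar> < \<epsilon>" and a0: "\<bar>a0\<bar> * (60 * B) < 1"
    using wave_domainE by metis
  have B: "B > 0" by (rule good_boxD(2)[OF box])
  \<comment> \<open>Order 0 of the correction series is zero, which leaves that slot for c_0. As a
    holomorphic function of \<kappa>, it is then expanded along with the corrections.\<close>
  define G :: "nat \<Rightarrow> real \<Rightarrow> complex \<Rightarrow> complex" where
    "G = (\<lambda>n z \<kappa>. if n = 0 then of_real \<gamma> / \<kappa>\<^sup>2 + of_real \<beta> * \<kappa>\<^sup>2 else stokes_speed (response \<gamma> \<beta> \<kappa>) n)"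
  show "\<exists>r > 0. \<exists>C :: nat \<Rightarrow> nat \<Rightarrow> real \<Rightarrow> real. \<exists>M :: nat \<Rightarrow> nat \<Rightarrow> real.
       (\<forall>i j z. \<bar>C i j z\<bar> \<le> M i j) \<and>
       (\<forall>a k. (a - a0)^2 + (k - k0)^2 < r^2 \<longrightarrow>
          (\<lambda>(i, j). M i j * \<bar>a - a0\<bar>^i * \<bar>k - k0\<bar>^j) summable_on UNIV \<and>
          (\<forall>z. ((\<lambda>(i, l). C i l z * (a - a0)^i * (k - k0)^l) has_sum wave_speed \<gamma> \<beta> a k) UNIV))"
  proof (rule double_series_expansion[where G = G and K = "B + 2 / (5 * B)" and R = "60 * B"])
    show "G n z holomorphic_on ball (of_real k1) \<epsilon>" for n z
    proof (cases "n = 0")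
      case True
      thus ?thesis using good_boxD(3)[OF box] by (auto simp: G_def intro!: holomorphic_intros)
    next
      case False
      thus ?thesis using holomorphic_stokes(2)[OF box] by (simp add: G_def)
    qed
    show "norm (G n z \<kappa>) \<le> (B + 2 / (5 * B)) * (60 * B) ^ n" if "\<kappa> \<in> ball (of_real k1) \<epsilon>" for n z \<kappa>
    proof (cases "n = 0")
      case True
      have "norm (of_real \<gamma> / \<kappa>\<^sup>2 + of_real \<beta> * \<kappa>\<^sup>2) \<le> B" by (rule good_boxD(4)[OF box that])
      also have "B \<le> B + 2 / (5 * B)" using B by simp
      finally show ?thesis using True by (simp add: G_def)
    next
      case False
      have "norm (stokes_speed (response \<gamma> \<beta> \<kappa>) n) \<le> 2 / (5 * B) * (20 * B) ^ n"
        by (rule good_box_bounds(3)[OF box that])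
      also have "\<dots> \<le> (B + 2 / (5 * B)) * (60 * B) ^ n"
        using B by (intro mult_mono power_mono) auto
      finally show ?thesis using False by (simp add: G_def)
    qed
    show "wave_speed \<gamma> \<beta> a k = Re (\<Sum>n. G n z (of_real k) * of_real a ^ n)"
      if "\<bar>a\<bar> * (60 * B) < 1" "\<bar>k - k1\<bar> < \<epsilon>" for a k z
    proof -
      let ?b = "response \<gamma> \<beta> (of_real k)"
      have "(\<lambda>n. (if n = 0 then of_real (c0_coef \<gamma> \<beta> k) else 0) + stokes_speed ?b n * of_real a ^ n) sums
          (of_real (c0_coef \<gamma> \<beta> k) + (\<Sum>n. stokes_speed ?b n * of_real a ^ n))"
        using sums_If_finite_set[of "{0}" "\<lambda>_. complex_of_real (c0_coef \<gamma> \<beta> k)"]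
        by (intro sums_add summable_sums summable_norm_cancel[OF summable_norm_speed[OF box that(2,1)]]) simp
      also have "(\<lambda>n. (if n = 0 then of_real (c0_coef \<gamma> \<beta> k) else 0) + stokes_speed ?b n * of_real a ^ n) =
          (\<lambda>n. G n z (of_real k) * of_real a ^ n)"
        by (auto simp: G_def fun_eq_iff c0_coef_def)
      finally show ?thesis by (simp add: sums_iff wave_speed_def)
    qed
  qed (use B a0 k0 in auto)
qed

section \<open>Asymptotic expansion and conclusion\<close>

lemma response_low_frequencies:
  obtains \<tau> \<sigma> :: real where
    "response \<gamma> \<beta> (of_real k) 2 = of_real (2 * A2_coef \<gamma> \<beta> k)"
    "response \<gamma> \<beta> (of_real k) 3 = of_real \<tau>"
    "response \<gamma> \<beta> (of_real k) 4 = of_real \<sigma>"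
    "A3_coef \<gamma> \<beta> k = A2_coef \<gamma> \<beta> k * \<tau>"
    "A44_coef \<gamma> \<beta> k = \<sigma> / 2 * ((A2_coef \<gamma> \<beta> k)\<^sup>2 + 2 * (A2_coef \<gamma> \<beta> k * \<tau>))"
proof -
  \<comment> \<open>The response at frequencies 3 and 4, with m^2 - 1 = 8 and 15 multiplied into the
    denominators.\<close>
  define \<tau> where "\<tau> = 9 * k\<^sup>2 / (8 * \<gamma> - 72 * \<beta> * k ^ 4)"
  define \<sigma> where "\<sigma> = 16 * k\<^sup>2 / (15 * \<gamma> - 240 * \<beta> * k ^ 4)"
  have A3: "A3_coef \<gamma> \<beta> k = A2_coef \<gamma> \<beta> k * \<tau>"
    by (simp add: A3_coef_def \<tau>_def)
  have "8 * x * y / d = 16 * x / d / 2 * y" for x y d :: real by simp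
  hence "A44_coef \<gamma> \<beta> k = \<sigma> / 2 * ((A2_coef \<gamma> \<beta> k)\<^sup>2 + 2 * (A2_coef \<gamma> \<beta> k * \<tau>))"
    unfolding A44_coef_def A3 \<sigma>_def .
  moreover have "response \<gamma> \<beta> (of_real k) 2 = of_real (2 * A2_coef \<gamma> \<beta> k)"
    "response \<gamma> \<beta> (of_real k) 3 = of_real \<tau>" "response \<gamma> \<beta> (of_real k) 4 = of_real \<sigma>"
    by (simp_all add: response_def A2_coef_def \<tau>_def \<sigma>_def right_diff_distrib mult_ac)
  ultimately show ?thesis using A3 that by blast
qed

text \<open>The wave is cut after order 4. The speed can be cut after order 5, whose coefficient is
  zero, which yields the sixth-order error.\<close>

lemma stokes_wave_asymptotics:
  assumes box: "good_box \<gamma> \<beta> k1 \<epsilon> B" and k: "\<bar>k - k1\<bar> < \<epsilon>" and a: "\<bar>a\<bar> * (60 * B) \<le> 1 / 2"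
  shows "\<bar>stokes_wave \<gamma> \<beta> a k z - (a * cos z + a^2 * A2_coef \<gamma> \<beta> k * cos (2 * z)
                 + a^3 * A3_coef \<gamma> \<beta> k * cos (3 * z)
                 + a^4 * (A42_coef \<gamma> \<beta> k * cos (2 * z) + A44_coef \<gamma> \<beta> k * cos (4 * z)))\<bar>
               \<le> 2 * (1 / (10 * B)) * (60 * B) ^ 5 * \<bar>a\<bar>^5"
    and "\<bar>wave_speed \<gamma> \<beta> a k - (c0_coef \<gamma> \<beta> k + a^2 * c2_coef \<gamma> \<beta> k + a^4 * c4_coef \<gamma> \<beta> k)\<bar>
               \<le> 2 * (2 / (5 * B)) * (20 * B) ^ 6 * \<bar>a\<bar>^6"
proof -
  let ?b = "response \<gamma> \<beta> (of_real k)"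
  have B: "B > 0" by (rule good_boxD(2)[OF box])
  have a1: "\<bar>a\<bar> * (60 * B) < 1" using a by linarith
  interpret convergent_expansion "stokes ?b" "1 / (10 * B)" "20 * B" a
    by (rule good_box_convergent[OF box of_real_in_ball[OF k] a1])
  obtain \<tau> \<sigma> where r: "?b 2 = of_real (2 * A2_coef \<gamma> \<beta> k)" "?b 3 = of_real \<tau>" "?b 4 = of_real \<sigma>"
    and A3: "A3_coef \<gamma> \<beta> k = A2_coef \<gamma> \<beta> k * \<tau>"
    and A44: "A44_coef \<gamma> \<beta> k = \<sigma> / 2 * ((A2_coef \<gamma> \<beta> k)\<^sup>2 + 2 * (A2_coef \<gamma> \<beta> k * \<tau>))"
    by (rule response_low_frequencies)
  note low = response_minus response_0 response_1 r
  have re: "Re (x * of_real a ^ n) = Re x * a ^ n" for x n by (simp flip: of_real_power)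
  have sum5: "{..<5} = {0, 1, 2, 3, 4::nat}" by auto
  have sum6: "{..<6} = {0, 1, 2, 3, 4, 5::nat}" by auto
  have "norm (trig 0 (stokes ?b n) n z) \<le> 1 / (10 * B) * (60 * B) ^ n" for n
    using norm_trig_T[of 0 n z] by simp
  from power_series_tail[OF this _ a, of 5] B
  have "norm (trig_series 0 (stokes ?b) a z - (\<Sum>n<5. trig 0 (stokes ?b n) n z * of_real a ^ n)) \<le>
      2 * (1 / (10 * B)) * (60 * B) ^ 5 * \<bar>a\<bar> ^ 5"
    by (simp add: trig_series_def)
  hence "\<bar>Re (trig_series 0 (stokes ?b) a z - (\<Sum>n<5. trig 0 (stokes ?b n) n z * of_real a ^ n))\<bar> \<le>
      2 * (1 / (10 * B)) * (60 * B) ^ 5 * \<bar>a\<bar> ^ 5"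
    using abs_Re_le_cmod order.trans by blast
  moreover have "Re (\<Sum>n<5. trig 0 (stokes ?b n) n z * of_real a ^ n) =
      a * cos z + a^2 * A2_coef \<gamma> \<beta> k * cos (2 * z)
                 + a^3 * A3_coef \<gamma> \<beta> k * cos (3 * z)
                 + a^4 * (A42_coef \<gamma> \<beta> k * cos (2 * z) + A44_coef \<gamma> \<beta> k * cos (4 * z))"
  proof -
    have "trig 0 (stokes ?b 0) 0 z = 0" by (simp add: trig_def)
    thus ?thesis
      unfolding sum5 Re_sum re A42_coef_def A3 A44
      using Re_trig_stokes[of ?b, OF low] by (simp add: ring_distribs mult_ac)
  qed
  ultimately show "\<bar>stokes_wave \<gamma> \<beta> a k z - (a * cos z + a^2 * A2_coef \<gamma> \<beta> k * cos (2 * z)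
                 + a^3 * A3_coef \<gamma> \<beta> k * cos (3 * z)
                 + a^4 * (A42_coef \<gamma> \<beta> k * cos (2 * z) + A44_coef \<gamma> \<beta> k * cos (4 * z)))\<bar>
               \<le> 2 * (1 / (10 * B)) * (60 * B) ^ 5 * \<bar>a\<bar>^5"
    by (simp only: minus_complex.sel stokes_wave_def)
  have "\<bar>a\<bar> * (20 * B) \<le> \<bar>a\<bar> * (60 * B)" using B by (intro mult_left_mono) auto
  hence a20: "\<bar>a\<bar> * (20 * B) \<le> 1 / 2" using a by linarith
  have "norm ((\<Sum>n. stokes_speed ?b n * of_real a ^ n) - (\<Sum>n<6. stokes_speed ?b n * of_real a ^ n)) \<le>
      2 * (2 / (5 * B)) * (20 * B) ^ 6 * \<bar>a\<bar> ^ 6"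
    by (rule power_series_tail[OF good_box_bounds(3)[OF box of_real_in_ball[OF k]] _ a20]) (use B in simp)
  hence "\<bar>Re ((\<Sum>n. stokes_speed ?b n * of_real a ^ n) - (\<Sum>n<6. stokes_speed ?b n * of_real a ^ n))\<bar> \<le>
      2 * (2 / (5 * B)) * (20 * B) ^ 6 * \<bar>a\<bar> ^ 6"
    using abs_Re_le_cmod order.trans by blast
  moreover have "Re (\<Sum>n<6. stokes_speed ?b n * of_real a ^ n) = a^2 * c2_coef \<gamma> \<beta> k + a^4 * c4_coef \<gamma> \<beta> k"
    unfolding sum6 Re_sum re c2_coef_def c4_coef_def A3
    by (simp add: stokes_speed_2[of ?b, OF low] stokes_speed_4[of ?b, OF low] stokes_speed_odd)
  ultimately show "\<bar>wave_speed \<gamma> \<beta> a k - (c0_coef \<gamma> \<beta> k + a^2 * c2_coef \<gamma> \<beta> k + a^4 * c4_coef \<gamma> \<beta> k)\<bar>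
               \<le> 2 * (2 / (5 * B)) * (20 * B) ^ 6 * \<bar>a\<bar>^6"
    by (simp add: wave_speed_def)
qed

theorem theorem2p1:
  fixes \<gamma> \<beta> :: real
  assumes "\<gamma> > 0" and "\<beta> \<noteq> 0"
  shows "\<exists>(U :: (real \<times> real) set) (w :: real \<Rightarrow> real \<Rightarrow> real \<Rightarrow> real) (c :: real \<Rightarrow> real \<Rightarrow> real).
    open U \<and>
    (\<forall>k. admissible_k \<gamma> \<beta> k \<longrightarrow> (0, k) \<in> U) \<and>
    (\<forall>(a, k) \<in> U. (-a, k) \<in> U) \<and>
    (\<forall>(a, k) \<in> U.
       smooth_fun (w a k) \<and>
       (\<forall>z. w a k (z + 2 * pi) = w a k z) \<and>
       (\<forall>z. w a k (- z) = w a k z) \<and>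
       c (- a) k = c a k \<and>
       (\<forall>z. c a k * k^2 * dz 2 (w a k) z + \<beta> * k^4 * dz 4 (w a k) z
             - k^2 * dz 2 (\<lambda>y. (w a k y)^2) z + \<gamma> * w a k z = 0)) \<and>
    (\<forall>j \<le> 4. fam_analytic_on (\<lambda>a k. dz j (w a k)) U) \<and>
    fam_analytic_on (\<lambda>a k z. c a k) U \<and>
    (\<forall>k. admissible_k \<gamma> \<beta> k \<longrightarrow>
       (\<exists>\<delta> > 0. \<exists>C. \<forall>a. \<bar>a\<bar> < \<delta> \<longrightarrow>
          (a, k) \<in> U \<and>
          (\<forall>z. \<bar>w a k z - (a * cos z + a^2 * A2_coef \<gamma> \<beta> k * cos (2 * z)
                 + a^3 * A3_coef \<gamma> \<beta> k * cos (3 * z)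
                 + a^4 * (A42_coef \<gamma> \<beta> k * cos (2 * z) + A44_coef \<gamma> \<beta> k * cos (4 * z)))\<bar>
               \<le> C * \<bar>a\<bar>^5) \<and>
          \<bar>c a k - (c0_coef \<gamma> \<beta> k + a^2 * c2_coef \<gamma> \<beta> k + a^4 * c4_coef \<gamma> \<beta> k)\<bar>
               \<le> C * \<bar>a\<bar>^6))"
proof (intro exI[of _ "wave_domain \<gamma> \<beta>"] exI[of _ "stokes_wave \<gamma> \<beta>"] exI[of _ "wave_speed \<gamma> \<beta>"] conjI)
  show "open (wave_domain \<gamma> \<beta>)" by (rule open_wave_domain)
  show "\<forall>k. admissible_k \<gamma> \<beta> k \<longrightarrow> (0, k) \<in> wave_domain \<gamma> \<beta>"
  proof (intro allI impI)
    fix k assume "admissible_k \<gamma> \<beta> k"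
    then obtain \<epsilon> B where box: "good_box \<gamma> \<beta> k \<epsilon> B" using admissible_good_box assms by metis
    show "(0, k) \<in> wave_domain \<gamma> \<beta>" by (rule wave_domainI[OF box]) (use good_boxD(1)[OF box] in simp_all)
  qed
  show "\<forall>(a, k)\<in>wave_domain \<gamma> \<beta>. (- a, k) \<in> wave_domain \<gamma> \<beta>"
    by (auto elim!: wave_domainE intro: wave_domainI)
  show "\<forall>(a, k)\<in>wave_domain \<gamma> \<beta>.
       smooth_fun (stokes_wave \<gamma> \<beta> a k) \<and>
       (\<forall>z. stokes_wave \<gamma> \<beta> a k (z + 2 * pi) = stokes_wave \<gamma> \<beta> a k z) \<and>
       (\<forall>z. stokes_wave \<gamma> \<beta> a k (- z) = stokes_wave \<gamma> \<beta> a k z) \<and>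
       wave_speed \<gamma> \<beta> (- a) k = wave_speed \<gamma> \<beta> a k \<and>
       (\<forall>z. wave_speed \<gamma> \<beta> a k * k^2 * dz 2 (stokes_wave \<gamma> \<beta> a k) z + \<beta> * k^4 * dz 4 (stokes_wave \<gamma> \<beta> a k) z
             - k^2 * dz 2 (\<lambda>y. (stokes_wave \<gamma> \<beta> a k y)^2) z + \<gamma> * stokes_wave \<gamma> \<beta> a k z = 0)"
  proof (rule ballI, rule prod.splits(1)[THEN iffD2], intro allI impI)
    fix p a k assume "p \<in> wave_domain \<gamma> \<beta>" "p = (a, k)"
    then obtain k1 \<epsilon> B where box: "good_box \<gamma> \<beta> k1 \<epsilon> B" "\<bar>k - k1\<bar> < \<epsilon>" "\<bar>a\<bar> * (60 * B) < 1"
      using wave_domainE by metis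
    show "smooth_fun (stokes_wave \<gamma> \<beta> a k) \<and>
       (\<forall>z. stokes_wave \<gamma> \<beta> a k (z + 2 * pi) = stokes_wave \<gamma> \<beta> a k z) \<and>
       (\<forall>z. stokes_wave \<gamma> \<beta> a k (- z) = stokes_wave \<gamma> \<beta> a k z) \<and>
       wave_speed \<gamma> \<beta> (- a) k = wave_speed \<gamma> \<beta> a k \<and>
       (\<forall>z. wave_speed \<gamma> \<beta> a k * k^2 * dz 2 (stokes_wave \<gamma> \<beta> a k) z + \<beta> * k^4 * dz 4 (stokes_wave \<gamma> \<beta> a k) z
             - k^2 * dz 2 (\<lambda>y. (stokes_wave \<gamma> \<beta> a k y)^2) z + \<gamma> * stokes_wave \<gamma> \<beta> a k z = 0)"
      by (intro conjI allI smooth_stokes_wave[OF box] stokes_wave_periodic[OF box] stokes_wave_even[OF box]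
          wave_speed_even stokes_wave_equation[OF box])
  qed
  show "\<forall>j\<le>4. fam_analytic_on (\<lambda>a k. dz j (stokes_wave \<gamma> \<beta> a k)) (wave_domain \<gamma> \<beta>)"
    by (intro allI impI fam_analytic_stokes_wave)
  show "fam_analytic_on (\<lambda>a k z. wave_speed \<gamma> \<beta> a k) (wave_domain \<gamma> \<beta>)"
    by (rule fam_analytic_wave_speed)
  show "\<forall>k. admissible_k \<gamma> \<beta> k \<longrightarrow>
       (\<exists>\<delta> > 0. \<exists>C. \<forall>a. \<bar>a\<bar> < \<delta> \<longrightarrow>
          (a, k) \<in> wave_domain \<gamma> \<beta> \<and>
          (\<forall>z. \<bar>stokes_wave \<gamma> \<beta> a k z - (a * cos z + a^2 * A2_coef \<gamma> \<beta> k * cos (2 * z)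
                 + a^3 * A3_coef \<gamma> \<beta> k * cos (3 * z)
                 + a^4 * (A42_coef \<gamma> \<beta> k * cos (2 * z) + A44_coef \<gamma> \<beta> k * cos (4 * z)))\<bar>
               \<le> C * \<bar>a\<bar>^5) \<and>
          \<bar>wave_speed \<gamma> \<beta> a k - (c0_coef \<gamma> \<beta> k + a^2 * c2_coef \<gamma> \<beta> k + a^4 * c4_coef \<gamma> \<beta> k)\<bar>
               \<le> C * \<bar>a\<bar>^6)"
  proof (intro allI impI)
    fix k assume "admissible_k \<gamma> \<beta> k"
    then obtain \<epsilon> B where box: "good_box \<gamma> \<beta> k \<epsilon> B" using admissible_good_box assms by metis
    have B: "B > 0" and \<epsilon>: "\<epsilon> > 0" by (rule good_boxD[OF box])+
    have k: "\<bar>k - k\<bar> < \<epsilon>" using \<epsilon> by simp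
    define C1 where "C1 = 2 * (1 / (10 * B)) * (60 * B) ^ 5"
    define C2 where "C2 = 2 * (2 / (5 * B)) * (20 * B) ^ 6"
    define C where "C = max C1 C2"
    show "\<exists>\<delta> > 0. \<exists>C. \<forall>a. \<bar>a\<bar> < \<delta> \<longrightarrow>
          (a, k) \<in> wave_domain \<gamma> \<beta> \<and>
          (\<forall>z. \<bar>stokes_wave \<gamma> \<beta> a k z - (a * cos z + a^2 * A2_coef \<gamma> \<beta> k * cos (2 * z)
                 + a^3 * A3_coef \<gamma> \<beta> k * cos (3 * z)
                 + a^4 * (A42_coef \<gamma> \<beta> k * cos (2 * z) + A44_coef \<gamma> \<beta> k * cos (4 * z)))\<bar>
               \<le> C * \<bar>a\<bar>^5) \<and>
          \<bar>wave_speed \<gamma> \<beta> a k - (c0_coef \<gamma> \<beta> k + a^2 * c2_coef \<gamma> \<beta> k + a^4 * c4_coef \<gamma> \<beta> k)\<bar>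
               \<le> C * \<bar>a\<bar>^6"
    proof (rule exI[of _ "1 / (120 * B)"], intro exI[of _ C] conjI allI impI)
      \<comment> \<open>Half of the radius 1 / (60 B) on which the expansion converges, as the tail
        estimate requires.\<close>
      show "0 < 1 / (120 * B)" using B by simp
      fix a :: real assume "\<bar>a\<bar> < 1 / (120 * B)"
      hence a: "\<bar>a\<bar> * (60 * B) < 1 / 2" using B by (simp add: field_simps)
      show "(a, k) \<in> wave_domain \<gamma> \<beta>" using a by (intro wave_domainI[OF box _ k]) linarith
      note asym = stokes_wave_asymptotics[OF box k less_imp_le[OF a], folded C1_def C2_def]
      have C: "C1 * \<bar>a\<bar> ^ 5 \<le> C * \<bar>a\<bar> ^ 5" "C2 * \<bar>a\<bar> ^ 6 \<le> C * \<bar>a\<bar> ^ 6"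
        by (intro mult_right_mono; simp add: C_def)+
      show "\<bar>wave_speed \<gamma> \<beta> a k - (c0_coef \<gamma> \<beta> k + a^2 * c2_coef \<gamma> \<beta> k + a^4 * c4_coef \<gamma> \<beta> k)\<bar>
               \<le> C * \<bar>a\<bar>^6"
        by (rule order.trans[OF asym(2) C(2)])
      fix z :: real
      show "\<bar>stokes_wave \<gamma> \<beta> a k z - (a * cos z + a^2 * A2_coef \<gamma> \<beta> k * cos (2 * z)
                 + a^3 * A3_coef \<gamma> \<beta> k * cos (3 * z)
                 + a^4 * (A42_coef \<gamma> \<beta> k * cos (2 * z) + A44_coef \<gamma> \<beta> k * cos (4 * z)))\<bar>
               \<le> C * \<bar>a\<bar>^5"
        by (rule order.trans[OF asym(1) C(1)])
    qed
  qed
qed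

end
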